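(* Let $p>2$, let $\mathcal{D}\subset\mathbb{H}$ be open, bounded and connected, and let $F\in\mathcal{C}(\mathbb{H})$ be bounded. For every $\epsilon\in(0,1)$ let $u_I^\epsilon$, $u_{II}^\epsilon$ be the game values $$u_I^\epsilon(q)=\sup_{\sigma_I}\inf_{\sigma_{II}}\mathbb{E}\big[F\circ(Q^{\epsilon,q,\sigma_I,\sigma_{II}})_{\tau^{\epsilon,q,\sigma_I,\sigma_{II}}-1}\big],\qquad u_{II}^\epsilon(q)=\inf_{\sigma_{II}}\sup_{\sigma_I}\mathbb{E}\big[F\circ(Q^{\epsilon,q,\sigma_I,\sigma_{II}})_{\tau^{\epsilon,q,\sigma_I,\sigma_{II}}-1}\big],$$ and let $u_\epsilon$ be the unique bounded continuous solution of the dynamic programming principle $$u(q)=d_\epsilon(q)\Big(\frac13\mathcal{A}_3(u,\epsilon)(q)+\frac13\inf_{q'\in B_{\gamma_p\epsilon}(q)}\mathcal{A}_3(u,\epsilon)(q')+\frac13\sup_{q'\in B_{\gamma_p\epsilon}(q)}\mathcal{A}_3(u,\epsilon)(q')\Big)+(1-d_\epsilon(q))F(q),\quad q\in\mathbb{H}.$$ Then $u_I^\epsilon=u_\epsilon=u_{II}^\epsilon$ on $\mathbb{H}$.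
   Context: $\mathbb{H}=(\mathbb{R}^3,* )$ is the first Heisenberg group with $(x,y,z)*(x',y',z')=(x+x',y+y',z+z'+\frac12(xy'-yx'))$. The Korányi gauge is $|(x,y,z)|_K=((x^2+y^2)^2+16z^2)^{1/4}$, the metric is $d(q,q')=|q^{-1}*q'|_K$, $B_r(q)=\{q'\in\mathbb{H}: d(q,q')<r\}$, and the dilations are $\rho_\lambda(x,y,z)=(\lambda x,\lambda y,\lambda^2z)$. Define $\mathcal{A}_3(v,r)(q)=\frac{1}{|B_r(q)|}\int_{B_r(q)}v(p)\,dp$ (Lebesgue measure on $\mathbb{R}^3$), $d_\epsilon(q)=\frac1\epsilon\min\{\epsilon,\mathrm{dist}(q,\mathbb{H}\setminus\mathcal{D})\}$ with $\mathrm{dist}$ taken with respect to $d$, and $\gamma_p=\big(\frac{p-2}{\pi}\big)^{1/2}$. Tug of War game with noise on $\mathcal{D}$: let $\Omega_1=B_1(0)\times\{1,2,3\}\times(0,1)$ with the product $\mathbb{P}_1$ of normalized Lebesgue measure on $B_1(0)$, uniform measure on $\{1,2,3\}$ and Lebesgue measure on $(0,1)$ (Borel/discrete $\sigma$-algebras), and let $(\Omega,\mathcal{F},\mathbb{P})$ be the countable product of copies of $\Omega_1$, with elements $\omega=\{(w_i,s_i,t_i)\}_{i\ge1}$. A strategy of a player is a sequence $\sigma=\{\sigma^n\}_{n\ge0}$ of measurable functions $\sigma^n:H_n\to B_1(0)$ on the spaces of finite histories $H_n=\mathbb{H}\times(\mathbb{H}\times\Omega_1)^n$. Given $\epsilon\in(0,1)$,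 an initial position $q_0\in\mathbb{H}$ and strategies $\sigma_I,\sigma_{II}$ of the two players, the positions $Q_n=Q_n^{\epsilon,q_0,\sigma_I,\sigma_{II}}:\Omega\to\mathbb{H}$ are: $Q_0=q_0$ and, with $q_k=Q_k$ and $h_{n-1}=(q_0,(q_1,w_1,s_1,t_1),\ldots,(q_{n-1},w_{n-1},s_{n-1},t_{n-1}))\in H_{n-1}$, $$Q_n=\begin{cases}q_{n-1}*\rho_{\gamma_p\epsilon}(\sigma_I^{n-1}(h_{n-1}))*\rho_\epsilon(w_n)& s_n=1\\ q_{n-1}*\rho_{\gamma_p\epsilon}(\sigma_{II}^{n-1}(h_{n-1}))*\rho_\epsilon(w_n)& s_n=2\\ q_{n-1}*\rho_\epsilon(w_n)& s_n=3.\end{cases}$$ The stopping time is $\tau=\tau^{\epsilon,q_0,\sigma_I,\sigma_{II}}=\min\{n\ge1:\ t_n>d_\epsilon(q_{n-1})\}$, which is almost surely finite. *)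

theory Defs
  imports "HOL-Probability.Probability"
begin

text \<open>
  The Heisenberg group is modelled on \<open>\<real>\<^sup>3\<close>. Its Koranyi metric induces the Euclidean topology and the
  same bounded sets, so the library notions \<open>open\<close>, \<open>bounded\<close>, \<open>connected\<close>, \<open>continuous_on\<close>, \<open>borel\<close>
  and \<open>lborel\<close> of the product type are the intended ones. The group identity is \<open>0 = (0, 0, 0)\<close>.
\<close>

type_synonym heis = "real \<times> real \<times> real"

fun hmul :: "heis \<Rightarrow> heis \<Rightarrow> heis" (infixl "\<star>" 70) where
  "(x, y, z) \<star> (x', y', z') = (x + x', y + y', z + z' + (x * y' - y * x') / 2)"

fun hinv :: "heis \<Rightarrow> heis" where
  "hinv (x, y, z) = (- x, - y, - z)"

fun koranyi :: "heis \<Rightarrow> real" where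
  "koranyi (x, y, z) = root 4 ((x\<^sup>2 + y\<^sup>2)\<^sup>2 + 16 * z\<^sup>2)"

fun dil :: "real \<Rightarrow> heis \<Rightarrow> heis" where
  "dil l (x, y, z) = (l * x, l * y, l\<^sup>2 * z)"

definition hdist :: "heis \<Rightarrow> heis \<Rightarrow> real" where
  "hdist q q' = koranyi (hinv q \<star> q')"

definition hball :: "heis \<Rightarrow> real \<Rightarrow> heis set" where
  "hball q r = {q'. hdist q q' < r}"

definition A3 :: "(heis \<Rightarrow> real) \<Rightarrow> real \<Rightarrow> heis \<Rightarrow> real" where
  "A3 v r q = 1 / measure lborel (hball q r) * (LINT p:hball q r|lborel. v p)"

definition hsetdist :: "heis \<Rightarrow> heis set \<Rightarrow> real" where
  "hsetdist q A = (INF q'\<in>A. hdist q q')"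

definition d_eps :: "heis set \<Rightarrow> real \<Rightarrow> heis \<Rightarrow> real" where
  "d_eps D \<epsilon> q = 1 / \<epsilon> * min \<epsilon> (hsetdist q (- D))"

definition gam :: "real \<Rightarrow> real" where
  "gam p = sqrt ((p - 2) / pi)"

definition dpp :: "real \<Rightarrow> heis set \<Rightarrow> (heis \<Rightarrow> real) \<Rightarrow> real \<Rightarrow> (heis \<Rightarrow> real) \<Rightarrow> bool" where
  "dpp p D F \<epsilon> u \<longleftrightarrow>
    (\<forall>q. u q = d_eps D \<epsilon> q *
           (1/3 * A3 u \<epsilon> q
            + 1/3 * (INF q'\<in>hball q (gam p * \<epsilon>). A3 u \<epsilon> q')
            + 1/3 * (SUP q'\<in>hball q (gam p * \<epsilon>). A3 u \<epsilon> q'))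
         + (1 - d_eps D \<epsilon> q) * F q)"

text \<open>An element \<open>(w, s, t)\<close> of \<open>\<Omega>\<^sub>1\<close>: noise, coin and stopping variable of one round.\<close>

type_synonym outcome = "heis \<times> nat \<times> real"

definition Omega1 :: "outcome measure" where
  "Omega1 = uniform_measure (restrict_space lborel (hball 0 1)) (hball 0 1)
            \<Otimes>\<^sub>M (uniform_count_measure {1, 2, 3} \<Otimes>\<^sub>M restrict_space lborel {0<..<1})"

definition Omega :: "(nat \<Rightarrow> outcome) measure" where
  "Omega = Pi\<^sub>M {1..} (\<lambda>_. Omega1)"

text \<open>
  A history \<open>(q\<^sub>0, (q\<^sub>1, w\<^sub>1, s\<^sub>1, t\<^sub>1), \<dots>, (q\<^sub>n, w\<^sub>n, s\<^sub>n, t\<^sub>n))\<close> is a pair whose second component is a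
  function on \<open>{1..n}\<close>, taking the value \<open>undefined\<close> elsewhere (the convention of \<open>Pi\<^sub>M\<close>).
\<close>

type_synonym history = "heis \<times> (nat \<Rightarrow> heis \<times> outcome)"
type_synonym strategy = "nat \<Rightarrow> history \<Rightarrow> heis"

definition Hist :: "nat \<Rightarrow> history measure" where
  "Hist n = borel \<Otimes>\<^sub>M Pi\<^sub>M {1..n} (\<lambda>_. borel \<Otimes>\<^sub>M Omega1)"

definition strategies :: "strategy set" where
  "strategies = {\<sigma>. \<forall>n. \<sigma> n \<in> measurable (Hist n) (restrict_space borel (hball 0 1))}"

fun position ::
  "real \<Rightarrow> real \<Rightarrow> heis \<Rightarrow> strategy \<Rightarrow> strategy \<Rightarrow> (nat \<Rightarrow> outcome) \<Rightarrow> nat \<Rightarrow> heis" where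
  "position p \<epsilon> q0 \<sigma>I \<sigma>II \<omega> 0 = q0"
| "position p \<epsilon> q0 \<sigma>I \<sigma>II \<omega> (Suc n) =
    (let q = position p \<epsilon> q0 \<sigma>I \<sigma>II \<omega> n;
         h = (q0, \<lambda>i. if i \<in> {1..n} then (position p \<epsilon> q0 \<sigma>I \<sigma>II \<omega> i, \<omega> i) else undefined);
         (w, s, t) = \<omega> (Suc n)
     in if s = 1 then q \<star> dil (gam p * \<epsilon>) (\<sigma>I n h) \<star> dil \<epsilon> w
        else if s = 2 then q \<star> dil (gam p * \<epsilon>) (\<sigma>II n h) \<star> dil \<epsilon> w
        else q \<star> dil \<epsilon> w)"

text \<open>
  On the null event that the game never stops, \<open>LEAST\<close> yields an unspecified natural number that does
  not depend on \<open>\<omega>\<close>, which does not affect the expectations below.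
\<close>

definition stop ::
  "real \<Rightarrow> heis set \<Rightarrow> real \<Rightarrow> heis \<Rightarrow> strategy \<Rightarrow> strategy \<Rightarrow> (nat \<Rightarrow> outcome) \<Rightarrow> nat" where
  "stop p D \<epsilon> q0 \<sigma>I \<sigma>II \<omega> =
    (LEAST n. 1 \<le> n \<and> snd (snd (\<omega> n)) > d_eps D \<epsilon> (position p \<epsilon> q0 \<sigma>I \<sigma>II \<omega> (n - 1)))"

definition expected_payoff ::
  "real \<Rightarrow> heis set \<Rightarrow> (heis \<Rightarrow> real) \<Rightarrow> real \<Rightarrow> heis \<Rightarrow> strategy \<Rightarrow> strategy \<Rightarrow> real" where
  "expected_payoff p D F \<epsilon> q \<sigma>I \<sigma>II =
    (LINT \<omega>|Omega. F (position p \<epsilon> q \<sigma>I \<sigma>II \<omega> (stop p D \<epsilon> q \<sigma>I \<sigma>II \<omega> - 1)))"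

definition value_I :: "real \<Rightarrow> heis set \<Rightarrow> (heis \<Rightarrow> real) \<Rightarrow> real \<Rightarrow> heis \<Rightarrow> real" where
  "value_I p D F \<epsilon> q =
    (SUP \<sigma>I\<in>strategies. INF \<sigma>II\<in>strategies. expected_payoff p D F \<epsilon> q \<sigma>I \<sigma>II)"

definition value_II :: "real \<Rightarrow> heis set \<Rightarrow> (heis \<Rightarrow> real) \<Rightarrow> real \<Rightarrow> heis \<Rightarrow> real" where
  "value_II p D F \<epsilon> q =
    (INF \<sigma>II\<in>strategies. SUP \<sigma>I\<in>strategies. expected_payoff p D F \<epsilon> q \<sigma>I \<sigma>II)"

end

theory Submission
  imports Defs
begin

text \<open>
  Fix strategies and compare the payoff with the values of \<open>u\<close> along the play: by the dynamic
  programming principle, replacing ``stopped payoff, or else \<open>u\<close> at the current position'' by the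
  same quantity one round later changes the expectation by at most \<open>\<delta>\<close> times the probability that
  the game still runs, provided one player always moves to a \<open>\<delta>\<close>-optimal point. Continuity of the
  averages of \<open>u\<close> lets this choice be made measurably, from a countable dense set of moves. The
  errors add up to \<open>\<delta>\<close> times the expected duration, which is bounded uniformly over all strategies
  because the noise acts unopposed in a third of the rounds.
\<close>

text \<open>Only upper bounds for the payoff are estimated. The equation survives a simultaneous
  change of sign of \<open>u\<close> and \<open>F\<close>, which swaps the equally weighted infimum
  and supremum, and a round is symmetric in the two moves. One strategy chasing the infimum
  therefore gives the upper bound from the seat of Player II and, with \<open>-F\<close>, the lower
  bound from the seat of Player I. The obstacle is a duration bound independent of the strategies,
  since a push of size \<open>gam p * \<epsilon>\<close> may exceed the noise and oppose the exit
  from \<open>D\<close>. A Lyapunov function built from an exponential of the first coordinate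
  overcomes it: with a large exponent, the gain from pure noise rounds outweighs anything the
  players do in the others. The duration bound then comes from the same one-round comparison, run
  with payoff zero and a negative error.\<close>

no_notation convolution (infix "\<star>" 50)

subsection \<open>The Heisenberg group\<close>

lemma hmul_eq:
  "q \<star> q' = (fst q + fst q', fst (snd q) + fst (snd q'),
     snd (snd q) + snd (snd q') + (fst q * fst (snd q') - fst (snd q) * fst q') / 2)"
  by (cases q; cases q') (simp add: prod_cases3)

lemma dil_eq: "dil l q = (l * fst q, l * fst (snd q), l\<^sup>2 * snd (snd q))"
  by (cases q) auto

lemma koranyi_eq:
  "koranyi q = root 4 (((fst q)\<^sup>2 + (fst (snd q))\<^sup>2)\<^sup>2 + 16 * (snd (snd q))\<^sup>2)"
  by (cases q) auto

lemma hinv_eq: "hinv q = (- fst q, - fst (snd q), - snd (snd q))"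
  by (cases q) auto

lemma continuous_on_hmul [continuous_intros]:
  "continuous_on S f \<Longrightarrow> continuous_on S g \<Longrightarrow> continuous_on S (\<lambda>x. f x \<star> g x)"
  unfolding hmul_eq by (intro continuous_intros; simp)

lemma continuous_on_dil [continuous_intros]:
  "continuous_on S f \<Longrightarrow> continuous_on S (\<lambda>x. dil l (f x))"
  unfolding dil_eq by (intro continuous_intros; simp)

lemma continuous_on_koranyi [continuous_intros]:
  "continuous_on S f \<Longrightarrow> continuous_on S (\<lambda>x. koranyi (f x))"
  unfolding koranyi_eq by (intro continuous_intros; simp)

lemma continuous_on_hinv [continuous_intros]:
  "continuous_on S f \<Longrightarrow> continuous_on S (\<lambda>x. hinv (f x))"
  unfolding hinv_eq by (intro continuous_intros; simp)

lemma borel_measurable_hmul [measurable (raw)]: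
  assumes "f \<in> borel_measurable M" "g \<in> borel_measurable M"
  shows "(\<lambda>x. f x \<star> g x) \<in> borel_measurable M"
  by (rule borel_measurable_continuous_Pair[OF assms]) (intro continuous_intros)

lemma borel_measurable_dil [measurable (raw)]:
  assumes "f \<in> borel_measurable M"
  shows "(\<lambda>x. dil l (f x)) \<in> borel_measurable M"
  using borel_measurable_continuous_on[OF _ assms, of "dil l"] by (simp add: continuous_intros)

lemma hinv_hmul_cancel: "hinv q \<star> (q \<star> q') = q'" "q \<star> (hinv q \<star> q') = q'"
  by (simp_all add: hmul_eq hinv_eq field_simps)

lemma zero_hmul [simp]: "0 \<star> q = q"
  by (simp add: hmul_eq)

lemma hinv_zero [simp]: "hinv 0 = 0"
  by (simp add: hinv_eq zero_prod_def)

lemma dil_dil: "dil l (dil m q) = dil (l * m) q"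
  by (simp add: dil_eq power2_eq_square field_simps)

lemma koranyi_nonneg [simp]: "0 \<le> koranyi q"
  by (simp add: koranyi_eq)

lemma koranyi_dil: "0 \<le> l \<Longrightarrow> koranyi (dil l q) = l * koranyi q"
proof -
  assume l: "0 \<le> l"
  have "((l * fst q)\<^sup>2 + (l * fst (snd q))\<^sup>2)\<^sup>2 + 16 * (l\<^sup>2 * snd (snd q))\<^sup>2 =
      l ^ 4 * (((fst q)\<^sup>2 + (fst (snd q))\<^sup>2)\<^sup>2 + 16 * (snd (snd q))\<^sup>2)"
    by (simp add: algebra_simps power2_eq_square power4_eq_xxxx)
  then show ?thesis
    using l by (simp add: koranyi_eq dil_eq real_root_mult real_root_power_cancel)
qed

lemma hdist_nonneg [simp]: "0 \<le> hdist q q'"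
  by (simp add: hdist_def)

lemma hdist_self [simp]: "hdist q q = 0"
  by (simp add: hdist_def koranyi_eq hmul_eq hinv_eq)

lemma continuous_on_hdist [continuous_intros]:
  "continuous_on S f \<Longrightarrow> continuous_on S g \<Longrightarrow> continuous_on S (\<lambda>x. hdist (f x) (g x))"
  unfolding hdist_def by (intro continuous_intros)

lemma open_hball: "open (hball q r)"
  unfolding hball_def by (intro open_Collect_less continuous_intros)

lemma hball_borel [measurable]: "hball q r \<in> sets borel"
  by (simp add: open_hball)

lemma mem_hball_zero: "w \<in> hball 0 r \<longleftrightarrow> koranyi w < r"
  by (simp add: hball_def hdist_def)

lemma hmul_dil_mem_hball: "0 < r \<Longrightarrow> q \<star> dil r w \<in> hball q r \<longleftrightarrow> w \<in> hball 0 1"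
  by (simp add: hball_def hdist_def hinv_hmul_cancel koranyi_dil)

text \<open>Left invariance and homogeneity of the gauge reduce every ball to the unit ball, which
  carries both the players' moves and the noise.\<close>

lemma hball_eq_image:
  assumes "0 < r" shows "hball q r = (\<lambda>w. q \<star> dil r w) ` hball 0 1"
proof (intro equalityI subsetI)
  fix q' assume q': "q' \<in> hball q r"
  have "q \<star> dil r (dil (1 / r) (hinv q \<star> q')) = q'"
    using assms by (simp add: dil_dil) (simp add: dil_eq hinv_hmul_cancel)
  then show "q' \<in> (\<lambda>w. q \<star> dil r w) ` hball 0 1"
    using q' assms by (metis hmul_dil_mem_hball image_eqI)
next
  fix q' assume "q' \<in> (\<lambda>w. q \<star> dil r w) ` hball 0 1"
  then obtain w where "q' = q \<star> dil r w" "w \<in> hball 0 1" by blast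
  then show "q' \<in> hball q r" using assms by (simp only: hmul_dil_mem_hball)
qed

section \<open>Size of the unit ball\<close>

lemma unit_hball_bounds:
  assumes "w \<in> hball 0 1"
  shows "\<bar>fst w\<bar> < 1" "\<bar>fst (snd w)\<bar> < 1" "\<bar>snd (snd w)\<bar> < 1"
proof -
  define a b c where "a = (fst w)\<^sup>2" "b = (fst (snd w))\<^sup>2" "c = (snd (snd w))\<^sup>2"
  have "root 4 ((a + b)\<^sup>2 + 16 * c) < 1"
    using assms by (simp add: mem_hball_zero koranyi_eq a_b_c_def)
  then have *: "(a + b)\<^sup>2 + 16 * c < 1"
    using real_root_lt_1_iff[of 4] by simp
  have nn: "0 \<le> a" "0 \<le> b" "0 \<le> c"
    by (auto simp: a_b_c_def)
  have "c < 1" using * nn zero_le_power2[of "a + b"] by linarith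
  moreover have "(a + b)\<^sup>2 < 1\<^sup>2" using * nn by simp
  then have "a + b < 1" using power2_less_imp_less[of "a + b" 1] by simp
  ultimately have "a < 1" "b < 1" "c < 1" using nn by linarith+
  then show "\<bar>fst w\<bar> < 1" "\<bar>fst (snd w)\<bar> < 1" "\<bar>snd (snd w)\<bar> < 1"
    by (simp_all add: a_b_c_def abs_square_less_1)
qed

lemma bounded_unit_hball: "bounded (hball 0 1)"
proof (rule bounded_subset)
  show "bounded ({-1..1} \<times> {-1..1} \<times> {-1..(1::real)} :: heis set)"
    by (intro bounded_Times bounded_closed_interval)
  show "hball 0 1 \<subseteq> {-1..1} \<times> {-1..1} \<times> {-1..1}"
  proof
    fix w assume "w \<in> hball 0 1"
    from unit_hball_bounds[OF this] show "w \<in> {-1..1} \<times> {-1..1} \<times> {-1..1}"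
      by (simp add: mem_Times_iff abs_less_iff)
  qed
qed

lemma emeasure_unit_hball_finite: "emeasure lborel (hball 0 1) < \<infinity>"
  by (rule emeasure_bounded_finite[OF bounded_unit_hball])

lemma emeasure_lborel_open_pos:
  fixes S :: "'a::euclidean_space set"
  assumes "open S" "S \<noteq> {}"
  shows "emeasure lborel S > 0"
proof (rule ccontr)
  assume "\<not> emeasure lborel S > 0"
  then have "S \<in> null_sets lborel"
    using assms by (auto simp: null_sets_def)
  then have "negligible S"
    by (simp add: negligible_iff_null_sets null_sets_completionI)
  then show False
    using open_not_negligible assms by blast
qed

lemma unit_hball_nonempty: "0 \<in> hball 0 1"
  by (simp add: mem_hball_zero koranyi_eq)

lemma measure_unit_hball_pos: "measure lborel (hball 0 1) > 0"
  using emeasure_lborel_open_pos[OF open_hball, of 0 1] unit_hball_nonempty emeasure_unit_hball_finite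
  by (auto simp: measure_def enn2real_positive_iff)

text \<open>The substitution is triangular: the group law shifts the third coordinate by a term in
  the first two only. Three affine substitutions on the line give the factor
  \<open>r * r * r\<^sup>2 = r ^ 4\<close>.\<close>

lemma nn_integral_hmul_dil:
  assumes f [measurable]: "f \<in> borel_measurable borel" and r: "0 < r"
  shows "(\<integral>\<^sup>+p. f p \<partial>lborel) = ennreal (r ^ 4) * (\<integral>\<^sup>+w. f (q \<star> dil r w) \<partial>lborel)"
proof -
  obtain a b c where q: "q = (a, b, c)" by (cases q)
  have iter: "(\<integral>\<^sup>+p. g p \<partial>lborel) = (\<integral>\<^sup>+x. \<integral>\<^sup>+y. \<integral>\<^sup>+z. g (x, y, z) \<partial>lborel \<partial>lborel \<partial>lborel)"
    if g: "g \<in> borel_measurable borel" for g :: "heis \<Rightarrow> ennreal"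
  proof -
    have g1 [measurable]: "g \<in> borel_measurable (lborel \<Otimes>\<^sub>M (lborel \<Otimes>\<^sub>M lborel))"
      using g by (simp add: lborel_prod)
    have "(\<integral>\<^sup>+p. g p \<partial>lborel) = (\<integral>\<^sup>+p. g p \<partial>(lborel \<Otimes>\<^sub>M (lborel \<Otimes>\<^sub>M lborel)))"
      by (simp add: lborel_prod)
    also have "\<dots> = (\<integral>\<^sup>+x. \<integral>\<^sup>+u. g (x, u) \<partial>(lborel \<Otimes>\<^sub>M lborel) \<partial>lborel)"
      by (subst sigma_finite_measure.nn_integral_fst[symmetric])
         (auto simp: lborel_prod g intro: lborel.sigma_finite_measure_axioms)
    also have "\<dots> = (\<integral>\<^sup>+x. \<integral>\<^sup>+y. \<integral>\<^sup>+z. g (x, y, z) \<partial>lborel \<partial>lborel \<partial>lborel)"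
      by (intro nn_integral_cong, subst lborel.nn_integral_fst[symmetric]) simp_all
    finally show ?thesis .
  qed
  have F [measurable]: "(\<lambda>(x, y, z). f (x, y, z)) \<in> borel_measurable (borel \<Otimes>\<^sub>M (borel \<Otimes>\<^sub>M borel))"
    by (simp add: borel_prod)
  have "(\<integral>\<^sup>+p. f p \<partial>lborel) = (\<integral>\<^sup>+x. \<integral>\<^sup>+y. \<integral>\<^sup>+z. f (x, y, z) \<partial>lborel \<partial>lborel \<partial>lborel)"
    by (rule iter) fact
  also have "\<dots> = r * (\<integral>\<^sup>+x. \<integral>\<^sup>+y. \<integral>\<^sup>+z. f (a + r * x, y, z) \<partial>lborel \<partial>lborel \<partial>lborel)"
    using r by (subst nn_integral_real_affine[where c = r and t = a]) auto
  also have "\<dots> = r * (\<integral>\<^sup>+x. r * (\<integral>\<^sup>+y. \<integral>\<^sup>+z. f (a + r * x, b + r * y, z) \<partial>lborel \<partial>lborel) \<partial>lborel)"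
    using r by (intro arg_cong2[where f = "(*)"] refl nn_integral_cong,
      subst nn_integral_real_affine[where c = r and t = b]) auto
  also have "\<dots> = r * (\<integral>\<^sup>+x. r * (\<integral>\<^sup>+y. r\<^sup>2 * (\<integral>\<^sup>+z. f (a + r * x, b + r * y,
      (c + (a * (r * y) - b * (r * x)) / 2) + r\<^sup>2 * z) \<partial>lborel) \<partial>lborel) \<partial>lborel)"
    using r by (intro arg_cong2[where f = "(*)"] refl nn_integral_cong,
      subst nn_integral_real_affine[where c = "r\<^sup>2"
        and t = "c + (a * (r * y) - b * (r * x)) / 2" for x y]) auto
  also have "\<dots> = r * (r * (r\<^sup>2 * (\<integral>\<^sup>+x. \<integral>\<^sup>+y. \<integral>\<^sup>+z. f (q \<star> dil r (x, y, z)) \<partial>lborel \<partial>lborel \<partial>lborel)))"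
    by (simp add: nn_integral_cmult q algebra_simps)
  also have "\<dots> = ennreal (r ^ 4) * (\<integral>\<^sup>+w. f (q \<star> dil r w) \<partial>lborel)"
    using r by (subst iter) (simp_all add: mult.assoc[symmetric] ennreal_mult[symmetric] power4_eq_xxxx power2_eq_square)
  finally show ?thesis .
qed

text \<open>As an identity of measures, the substitution rule passes to Bochner integrals of all
  Borel functions, integrable or not.\<close>

lemma lborel_eq_hmul_dil:
  assumes r: "0 < r"
  shows "lborel = density (distr lborel borel (\<lambda>w. q \<star> dil r w)) (\<lambda>_. ennreal (r ^ 4))"
proof (rule measure_eqI)
  fix A :: "heis set" assume "A \<in> sets lborel"
  then have [measurable]: "A \<in> sets borel" by simp
  have "emeasure lborel A = (\<integral>\<^sup>+p. indicator A p \<partial>lborel)" by simp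
  also have "\<dots> = ennreal (r ^ 4) * (\<integral>\<^sup>+w. indicator A (q \<star> dil r w) \<partial>lborel)"
    by (rule nn_integral_hmul_dil[OF _ r]) simp
  also have "(\<integral>\<^sup>+w. indicator A (q \<star> dil r w) \<partial>lborel) =
      emeasure (distr lborel borel (\<lambda>w. q \<star> dil r w)) A"
    by (subst nn_integral_indicator[symmetric], simp, subst nn_integral_distr) simp_all
  finally show "emeasure lborel A =
      emeasure (density (distr lborel borel (\<lambda>w. q \<star> dil r w)) (\<lambda>_. ennreal (r ^ 4))) A"
    by (simp add: emeasure_density nn_integral_cmult)
qed simp

lemma integral_hmul_dil:
  fixes f :: "heis \<Rightarrow> real"
  assumes f [measurable]: "f \<in> borel_measurable borel" and r: "0 < r"
  shows "(\<integral>p. f p \<partial>lborel) = r ^ 4 * (\<integral>w. f (q \<star> dil r w) \<partial>lborel)"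
  using r by (subst lborel_eq_hmul_dil[OF r, of q])
    (simp add: integral_density integral_distr)

section \<open>Noise and averages over balls\<close>

definition noise :: "heis measure" where
  "noise = uniform_measure (restrict_space lborel (hball 0 1)) (hball 0 1)"

lemma space_noise [simp]: "space noise = hball 0 1"
  by (simp add: noise_def space_restrict_space)

lemma sets_noise [measurable_cong]: "sets noise = sets (restrict_space borel (hball 0 1))"
  by (simp add: noise_def sets_restrict_space)

lemma prob_space_noise: "prob_space noise"
  unfolding noise_def
proof (rule prob_space_uniform_measure)
  have "emeasure lborel (hball 0 1) > 0"
    using unit_hball_nonempty by (intro emeasure_lborel_open_pos open_hball) blast
  then show "emeasure (restrict_space lborel (hball 0 1)) (hball 0 1) \<noteq> 0"
    by (simp add: emeasure_restrict_space)
  show "emeasure (restrict_space lborel (hball 0 1)) (hball 0 1) \<noteq> \<infinity>"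
    using emeasure_unit_hball_finite by (simp add: emeasure_restrict_space)
qed

lemma integral_noise:
  fixes f :: "heis \<Rightarrow> real"
  assumes [measurable]: "f \<in> borel_measurable borel"
  shows "integral\<^sup>L noise f = 1 / measure lborel (hball 0 1) * (LINT w:hball 0 1|lborel. f w)"
proof -
  let ?B = "hball 0 1"
  let ?R = "restrict_space lborel ?B"
  have m: "measure lborel ?B > 0" by (rule measure_unit_hball_pos)
  have e: "emeasure ?R ?B = ennreal (measure lborel ?B)"
    using emeasure_eq_ennreal_measure[of lborel ?B] emeasure_unit_hball_finite
    by (simp add: emeasure_restrict_space)
  have "noise = density ?R (\<lambda>w. ennreal (indicator ?B w / measure lborel ?B))"
    unfolding noise_def uniform_measure_def e
    using m by (auto intro!: arg_cong2[where f = density] simp: fun_eq_iff divide_ennreal ennreal_indicator[symmetric] simp del: ennreal_indicator)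
  moreover have "(\<lambda>w. indicator ?B w / measure lborel ?B) \<in> borel_measurable ?R"
    "f \<in> borel_measurable ?R"
    by (intro measurable_restrict_space1; simp)+
  ultimately have "integral\<^sup>L noise f = (\<integral>w. indicator ?B w / measure lborel ?B * f w \<partial>?R)"
    using integral_density[of f ?R "\<lambda>w. indicator ?B w / measure lborel ?B"] m by simp
  also have "\<dots> = (\<integral>w. indicator ?B w * (indicator ?B w / measure lborel ?B * f w) \<partial>lborel)"
    by (simp add: integral_restrict_space)
  also have "\<dots> = (\<integral>w. 1 / measure lborel ?B * (indicator ?B w * f w) \<partial>lborel)"
    by (intro Bochner_Integration.integral_cong) (auto simp: indicator_def)
  also have "\<dots> = 1 / measure lborel ?B * (LINT w:?B|lborel. f w)"
    unfolding set_lebesgue_integral_def by (simp only: integral_mult_right_zero real_scaleR_def)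
  finally show ?thesis .
qed

text \<open>Bridge between the equation and the game: the factor \<open>r ^ 4\<close> cancels
  between integral and volume, so a ball average is the expected value after a noise step from the
  centre. The measure no longer depends on \<open>q\<close>.\<close>

lemma A3_eq_noise:
  assumes v [measurable]: "v \<in> borel_measurable borel" and r: "0 < r"
  shows "A3 v r q = (\<integral>w. v (q \<star> dil r w) \<partial>noise)"
proof -
  have "indicator (hball q r) (q \<star> dil r w) = (indicator (hball 0 1) w :: real)" for w
    using r by (simp add: indicator_def hmul_dil_mem_hball)
  then have *: "(LINT p:hball q r|lborel. g p) = r ^ 4 * (LINT w:hball 0 1|lborel. g (q \<star> dil r w))"
    if [measurable]: "g \<in> borel_measurable borel" for g :: "heis \<Rightarrow> real"
    unfolding set_lebesgue_integral_def by (subst integral_hmul_dil[OF _ r, of _ q]) auto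
  have "measure lborel (hball q r) = (LINT p:hball q r|lborel. 1)"
    by (simp add: set_lebesgue_integral_def)
  also have "\<dots> = r ^ 4 * measure lborel (hball 0 1)"
    by (subst *) (auto simp: set_lebesgue_integral_def)
  finally show ?thesis
    using r by (simp add: A3_def * integral_noise)
qed

subsection \<open>One round of the game\<close>

lemma Omega1_eq:
  "Omega1 = noise \<Otimes>\<^sub>M (uniform_count_measure {1, 2, 3} \<Otimes>\<^sub>M restrict_space lborel {0<..<1})"
  by (simp add: Omega1_def noise_def)

lemma prob_space_unit_interval: "prob_space (restrict_space lborel {0<..<1::real})"
  by (rule prob_spaceI) (simp add: emeasure_restrict_space space_restrict_space)

lemma prob_space_Omega1: "prob_space Omega1"
  unfolding Omega1_eq
  by (intro prob_space_pair prob_space_noise prob_space_uniform_count_measure prob_space_unit_interval) auto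

lemma measurable_noise_borel: "f \<in> M \<rightarrow>\<^sub>M noise \<Longrightarrow> f \<in> borel_measurable M"
  using measurable_restrict_space2_iff[of f M borel "hball 0 1"]
  by (simp add: measurable_cong_sets[OF refl sets_noise])

lemma measurable_Omega1 [measurable (raw)]:
  assumes f: "f \<in> M \<rightarrow>\<^sub>M Omega1"
  shows "(\<lambda>x. fst (f x)) \<in> borel_measurable M"
    and "(\<lambda>x. fst (snd (f x))) \<in> M \<rightarrow>\<^sub>M count_space UNIV"
    and "(\<lambda>x. snd (snd (f x))) \<in> borel_measurable M"
proof -
  note * = f[unfolded Omega1_eq]
  show "(\<lambda>x. fst (f x)) \<in> borel_measurable M"
    by (rule measurable_noise_borel) (rule measurable_compose[OF * measurable_fst])
  have s: "(\<lambda>x. fst (snd (f x))) \<in> M \<rightarrow>\<^sub>M uniform_count_measure {1, 2, 3}"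
    by (rule measurable_compose[OF measurable_compose[OF * measurable_snd] measurable_fst])
  moreover have "(\<lambda>x. x) \<in> uniform_count_measure {1, 2, 3::nat} \<rightarrow>\<^sub>M count_space UNIV"
    by (simp add: measurable_cong_sets[OF sets_uniform_count_measure_count_space refl])
  ultimately show "(\<lambda>x. fst (snd (f x))) \<in> M \<rightarrow>\<^sub>M count_space UNIV"
    by (rule measurable_compose)
  have t: "(\<lambda>x. snd (snd (f x))) \<in> M \<rightarrow>\<^sub>M restrict_space lborel {0<..<1}"
    by (rule measurable_compose[OF measurable_compose[OF * measurable_snd] measurable_snd])
  then show "(\<lambda>x. snd (snd (f x))) \<in> borel_measurable M"
    by (simp add: measurable_restrict_space2_iff)
qed

text \<open>One transition with both moves already chosen, so that the outcome can be integrated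
  while they stay fixed.\<close>

definition next_pos :: "real \<Rightarrow> real \<Rightarrow> heis \<Rightarrow> heis \<Rightarrow> heis \<Rightarrow> outcome \<Rightarrow> heis" where
  "next_pos g \<epsilon> q x y a =
    (if fst (snd a) = 1 then q \<star> dil g x \<star> dil \<epsilon> (fst a)
     else if fst (snd a) = 2 then q \<star> dil g y \<star> dil \<epsilon> (fst a)
     else q \<star> dil \<epsilon> (fst a))"

lemma measurable_next_pos [measurable (raw)]:
  assumes [measurable]: "q \<in> borel_measurable M" "x \<in> borel_measurable M" "y \<in> borel_measurable M"
    "a \<in> M \<rightarrow>\<^sub>M Omega1"
  shows "(\<lambda>\<omega>. next_pos g \<epsilon> (q \<omega>) (x \<omega>) (y \<omega>) (a \<omega>)) \<in> borel_measurable M"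
  unfolding next_pos_def by measurable

lemma integral_unit_interval:
  fixes \<alpha> \<beta> d :: real
  assumes "0 \<le> d" "d \<le> 1"
  shows "(\<integral>t. (if t \<le> d then \<alpha> else \<beta>) \<partial>restrict_space lborel {0<..<1}) = d * \<alpha> + (1 - d) * \<beta>"
proof -
  let ?T = "restrict_space lborel {0<..<1::real}"
  interpret T: prob_space ?T by (rule prob_space_unit_interval)
  define A where "A = {t \<in> space ?T. t \<le> d}"
  \<comment> \<open>For \<open>d = 1\<close> the set \<open>{0<..d}\<close> would contain 1, which
    lies outside the sample space.\<close>
  have "A = (if d = 1 then {0<..<1} else {0<..d})"
    using assms by (auto simp: A_def space_restrict_space)
  moreover have "measure ?T (if d = 1 then {0<..<1} else {0<..d}) = d"
  proof (cases "d = 1")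
    case True
    then show ?thesis using T.prob_space by (simp add: space_restrict_space)
  next
    case False
    then have "{0<..d} \<subseteq> {0<..<1}" using assms by auto
    then show ?thesis using False assms by (simp add: measure_restrict_space)
  qed
  ultimately have m: "measure ?T A = d" by (simp only:)
  have S: "A \<in> sets ?T"
    unfolding A_def by measurable (simp add: measurable_restrict_space1)
  have "(\<integral>t. (if t \<le> d then \<alpha> else \<beta>) \<partial>?T) = (\<integral>t. \<beta> + (\<alpha> - \<beta>) * indicator A t \<partial>?T)"
    by (intro Bochner_Integration.integral_cong) (auto simp: indicator_def A_def)
  also have "\<dots> = (\<integral>t. \<beta> \<partial>?T) + (\<integral>t. (\<alpha> - \<beta>) * indicator A t \<partial>?T)"
    using S by (intro Bochner_Integration.integral_add integrable_mult_right integrable_real_indicator)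
      (auto simp: T.emeasure_eq_measure)
  also have "\<dots> = \<beta> + (\<alpha> - \<beta>) * d"
    using sets.sets_into_space[OF S] T.prob_space by (simp add: m Int_absorb2)
  finally show ?thesis by (simp add: algebra_simps)
qed

text \<open>The round survives with probability \<open>d\<close>, the coin has three equally likely
  faces, and the noise turns values into \<open>A3\<close>. The payoff \<open>c\<close> on stopping
  is known before the round.\<close>

lemma integral_Omega1_step:
  fixes v :: "heis \<Rightarrow> real"
  assumes v [measurable]: "v \<in> borel_measurable borel" and B: "\<And>q. \<bar>v q\<bar> \<le> B"
    and d: "0 \<le> d" "d \<le> 1" and \<epsilon>: "0 < \<epsilon>"
  shows "(\<integral>a. (if snd (snd a) \<le> d then v (next_pos g \<epsilon> q x y a) else c) \<partial>Omega1) =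
    d * (1/3 * A3 v \<epsilon> q + 1/3 * A3 v \<epsilon> (q \<star> dil g x) + 1/3 * A3 v \<epsilon> (q \<star> dil g y)) + (1 - d) * c"
proof -
  let ?C = "uniform_count_measure {1, 2, 3::nat}" and ?T = "restrict_space lborel {0<..<1::real}"
  interpret N: prob_space noise by (rule prob_space_noise)
  interpret C: prob_space ?C by (rule prob_space_uniform_count_measure) auto
  interpret T: prob_space ?T by (rule prob_space_unit_interval)
  interpret CT: pair_prob_space ?C ?T ..
  interpret O: pair_prob_space noise "?C \<Otimes>\<^sub>M ?T" ..
  let ?f = "\<lambda>a. if snd (snd a) \<le> d then v (next_pos g \<epsilon> q x y a) else c"
  have id [measurable]: "(\<lambda>a. a) \<in> Omega1 \<rightarrow>\<^sub>M Omega1" by simp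
  have fm: "?f \<in> borel_measurable Omega1" by measurable
  have bnd: "\<bar>?f a\<bar> \<le> max B \<bar>c\<bar>" for a
    using B by (simp add: le_max_iff_disj)
  have fi: "integrable Omega1 ?f"
  proof -
    interpret P: prob_space Omega1 by (rule prob_space_Omega1)
    show ?thesis by (rule P.integrable_const_bound[where B = "max B \<bar>c\<bar>"]) (use fm bnd in auto)
  qed
  have gm: "(\<lambda>b. ?f (w, b)) \<in> borel_measurable (?C \<Otimes>\<^sub>M ?T)" if "w \<in> space noise" for w
    by (rule measurable_Pair2[OF fm[unfolded Omega1_eq] that])
  have vi: "integrable noise (\<lambda>w. v (z \<star> dil \<epsilon> w))" for z
  proof (rule N.integrable_const_bound[where B = B])
    have [measurable]: "(\<lambda>w. w) \<in> borel_measurable noise"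
      by (rule measurable_noise_borel) simp
    show "(\<lambda>w. v (z \<star> dil \<epsilon> w)) \<in> borel_measurable noise" by measurable
  qed (use B in auto)
  have "(\<integral>a. ?f a \<partial>Omega1) = (\<integral>w. \<integral>b. ?f (w, b) \<partial>(?C \<Otimes>\<^sub>M ?T) \<partial>noise)"
    using O.integral_fst'[OF fi[unfolded Omega1_eq]] by (simp add: Omega1_eq)
  also have "\<dots> = (\<integral>w. d * (1/3 * v (q \<star> dil \<epsilon> w) + 1/3 * v (q \<star> dil g x \<star> dil \<epsilon> w)
      + 1/3 * v (q \<star> dil g y \<star> dil \<epsilon> w)) + (1 - d) * c \<partial>noise)"
  proof (rule Bochner_Integration.integral_cong[OF refl])
    fix w assume w: "w \<in> space noise"
    have gi: "integrable (?C \<Otimes>\<^sub>M ?T) (\<lambda>b. ?f (w, b))"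
      by (rule CT.integrable_const_bound[where B = "max B \<bar>c\<bar>", OF AE_I2 gm[OF w]])
        (unfold real_norm_def, rule bnd)
    have "(\<integral>b. ?f (w, b) \<partial>(?C \<Otimes>\<^sub>M ?T)) = (\<integral>s. \<integral>t. ?f (w, s, t) \<partial>?T \<partial>?C)"
      using CT.integral_fst'[OF gi] by simp
    \<comment> \<open>With noise and coin fixed, the integrand sees \<open>t\<close> only through
      the test \<open>t \<le> d\<close>. The 0 is a placeholder, since \<open>next_pos\<close>
      ignores that component.\<close>
    also have "\<dots> = (\<integral>s. d * v (next_pos g \<epsilon> q x y (w, s, 0)) + (1 - d) * c \<partial>?C)"
      by (intro Bochner_Integration.integral_cong refl
          trans[OF Bochner_Integration.integral_cong[OF refl] integral_unit_interval[OF d]])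
        (simp only: next_pos_def fst_conv snd_conv)
    also have "\<dots> = d * (1/3 * v (q \<star> dil \<epsilon> w) + 1/3 * v (q \<star> dil g x \<star> dil \<epsilon> w)
      + 1/3 * v (q \<star> dil g y \<star> dil \<epsilon> w)) + (1 - d) * c"
      unfolding next_pos_def by (simp add: integral_uniform_count_measure field_simps)
    finally show "(\<integral>b. ?f (w, b) \<partial>(?C \<Otimes>\<^sub>M ?T)) = d * (1/3 * v (q \<star> dil \<epsilon> w)
      + 1/3 * v (q \<star> dil g x \<star> dil \<epsilon> w) + 1/3 * v (q \<star> dil g y \<star> dil \<epsilon> w)) + (1 - d) * c" .
  qed
  also have "\<dots> = d * (1/3 * A3 v \<epsilon> q + 1/3 * A3 v \<epsilon> (q \<star> dil g x) + 1/3 * A3 v \<epsilon> (q \<star> dil g y))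
      + (1 - d) * c"
    unfolding A3_eq_noise[OF v \<epsilon>] using vi N.prob_space by simp
  finally show ?thesis .
qed

subsection \<open>The path space\<close>

lemma prob_space_Omega: "prob_space Omega"
  unfolding Omega_def by (intro prob_space_PiM prob_space_Omega1)

lemma measurable_Omega_component: "1 \<le> n \<Longrightarrow> (\<lambda>\<omega>. \<omega> n) \<in> Omega \<rightarrow>\<^sub>M Omega1"
  unfolding Omega_def by (rule measurable_component_singleton) simp

lemma measurable_Omega_Suc [measurable]: "(\<lambda>\<omega>. \<omega> (Suc n)) \<in> Omega \<rightarrow>\<^sub>M Omega1"
  by (rule measurable_Omega_component) simp

text \<open>Resampling one coordinate preserves the product measure; this replaces conditional expectations.\<close>

lemma integral_Omega_resample:
  fixes f :: "(nat \<Rightarrow> outcome) \<Rightarrow> real"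
  assumes f [measurable]: "f \<in> borel_measurable Omega" and B: "\<And>\<omega>. \<bar>f \<omega>\<bar> \<le> B" and n: "1 \<le> n"
  shows "(\<integral>\<omega>. f \<omega> \<partial>Omega) = (\<integral>\<omega>. \<integral>a. f (fun_upd \<omega> n a) \<partial>Omega1 \<partial>Omega)"
    and "(\<lambda>\<omega>. \<integral>a. f (fun_upd \<omega> n a) \<partial>Omega1) \<in> borel_measurable Omega"
proof -
  interpret P: prob_space Omega by (rule prob_space_Omega)
  interpret O1: prob_space Omega1 by (rule prob_space_Omega1)
  interpret PO: pair_prob_space Omega1 Omega ..
  \<comment> \<open>The index \<open>n\<close> is already present, so extending the product by one
    coordinate becomes overwriting coordinate \<open>n\<close>.\<close>
  have ins: "insert n {1..} = {1::nat..}" using n by auto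
  have distr: "distr (Omega1 \<Otimes>\<^sub>M Omega) Omega (\<lambda>(a, \<omega>). fun_upd \<omega> n a) = Omega"
    using distr_pair_PiM_eq_PiM[of "{1..}" "\<lambda>_. Omega1" n, OF prob_space_Omega1 prob_space_Omega1]
    by (simp only: Omega_def ins)
  have upd [measurable]: "(\<lambda>(a, \<omega>). fun_upd \<omega> n a) \<in> Omega1 \<Otimes>\<^sub>M Omega \<rightarrow>\<^sub>M Omega"
  proof -
    have "(\<lambda>(a, \<omega>). fun_upd \<omega> n a) \<in> Omega1 \<Otimes>\<^sub>M PiM {1..} (\<lambda>_. Omega1) \<rightarrow>\<^sub>M PiM (insert n {1..}) (\<lambda>_. Omega1)"
      by measurable
    then show ?thesis by (simp only: Omega_def ins)
  qed
  have m: "(\<lambda>(a, \<omega>). f (fun_upd \<omega> n a)) \<in> borel_measurable (Omega1 \<Otimes>\<^sub>M Omega)"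
    using measurable_compose[OF upd f] by (simp add: case_prod_unfold)
  have i: "integrable (Omega1 \<Otimes>\<^sub>M Omega) (\<lambda>(a, \<omega>). f (fun_upd \<omega> n a))"
    by (rule PO.integrable_const_bound[where B = B]) (use B m in auto)
  have "(\<integral>\<omega>. f \<omega> \<partial>Omega) = (\<integral>\<omega>. f \<omega> \<partial>distr (Omega1 \<Otimes>\<^sub>M Omega) Omega (\<lambda>(a, \<omega>). fun_upd \<omega> n a))"
    by (simp only: distr)
  also have "\<dots> = integral\<^sup>L (Omega1 \<Otimes>\<^sub>M Omega) (\<lambda>(a, \<omega>). f (fun_upd \<omega> n a))"
    by (subst integral_distr[OF upd f]) (simp add: case_prod_unfold)
  also have "\<dots> = (\<integral>\<omega>. \<integral>a. f (fun_upd \<omega> n a) \<partial>Omega1 \<partial>Omega)"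
    using PO.integral_snd[OF i] by simp
  finally show "(\<integral>\<omega>. f \<omega> \<partial>Omega) = (\<integral>\<omega>. \<integral>a. f (fun_upd \<omega> n a) \<partial>Omega1 \<partial>Omega)" .
  have "(\<lambda>(\<omega>, a). f (fun_upd \<omega> n a)) \<in> borel_measurable (Omega \<Otimes>\<^sub>M Omega1)"
    using measurable_pair_swap[OF m] by (simp add: case_prod_unfold)
  then show "(\<lambda>\<omega>. \<integral>a. f (fun_upd \<omega> n a) \<partial>Omega1) \<in> borel_measurable Omega"
    by (rule O1.borel_measurable_lebesgue_integral)
qed

text \<open>A non-integrable function has integral 0 by convention, so every bounded function
  qualifies. This bounds payoffs even for arbitrary functions in place of strategies.\<close>

lemma (in prob_space) abs_expectation_le:
  fixes f :: "'a \<Rightarrow> real"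
  assumes B: "\<And>x. \<bar>f x\<bar> \<le> B"
  shows "\<bar>expectation f\<bar> \<le> B"
proof (cases "integrable M f")
  case True
  have "\<bar>expectation f\<bar> \<le> expectation (\<lambda>x. \<bar>f x\<bar>)" by (rule integral_abs_bound)
  also have "\<dots> \<le> B" using True B by (intro integral_le_const) auto
  finally show ?thesis .
next
  case False
  have "0 \<le> B" using B[of undefined] by simp
  then show ?thesis using False by (simp add: not_integrable_integral_eq)
qed

subsection \<open>Playing with fixed strategies\<close>

lemma hsetdist_nonneg: "A \<noteq> {} \<Longrightarrow> 0 \<le> hsetdist q A"
  unfolding hsetdist_def by (rule cINF_greatest) auto

lemma hsetdist_mem: "q \<in> A \<Longrightarrow> hsetdist q A \<le> 0"
  using cINF_lower[of "hdist q" A q] bdd_belowI2[of A 0 "hdist q"] by (simp add: hsetdist_def)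

text \<open>An infimum of continuous functions is upper semicontinuous: its strict sublevel sets are
  unions of open sets.\<close>

lemma borel_measurable_hsetdist:
  assumes "A \<noteq> {}" shows "(\<lambda>q. hsetdist q A) \<in> borel_measurable borel"
  unfolding borel_measurable_iff_less
proof
  fix a :: real
  have "{q. hsetdist q A < a} = (\<Union>q'\<in>A. {q. hdist q q' < a})"
    unfolding hsetdist_def
    using assms by (subst cINF_less_iff) (auto intro: bdd_belowI2[where m = 0])
  moreover have "open \<dots>"
    by (intro open_UN ballI open_Collect_less continuous_intros)
  ultimately show "{q \<in> space borel. hsetdist q A < a} \<in> sets borel" by simp
qed

locale tug_of_war =
  fixes p \<epsilon> :: real and D :: "heis set"
  assumes eps_pos: "0 < \<epsilon>" and bounded_D: "bounded D"
begin

abbreviation "d \<equiv> d_eps D \<epsilon>"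
abbreviation "g \<equiv> gam p * \<epsilon>"

text \<open>The right-hand side of the dynamic programming principle with infimum and supremum
  replaced by the averages at the points the two moves reach. Its symmetry in \<open>x\<close> and
  \<open>y\<close> lets one strategy serve in either seat.\<close>

definition dpp_op :: "(heis \<Rightarrow> real) \<Rightarrow> (heis \<Rightarrow> real) \<Rightarrow> heis \<Rightarrow> heis \<Rightarrow> heis \<Rightarrow> real" where
  "dpp_op v F q x y =
    d q * (1/3 * A3 v \<epsilon> q + 1/3 * A3 v \<epsilon> (q \<star> dil g x) + 1/3 * A3 v \<epsilon> (q \<star> dil g y))
    + (1 - d q) * F q"

lemma Compl_D: "- D \<noteq> {}"
  using bounded_D not_bounded_UNIV by (metis Compl_empty_eq double_compl)

lemma d_nonneg: "0 \<le> d q" and d_le_1: "d q \<le> 1"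
  using eps_pos hsetdist_nonneg[OF Compl_D] by (auto simp: d_eps_def field_simps)

lemma d_outside: "q \<notin> D \<Longrightarrow> d q = 0"
  using hsetdist_mem[of q "- D"] hsetdist_nonneg[OF Compl_D, of q] eps_pos by (simp add: d_eps_def)

lemma d_measurable [measurable]: "d \<in> borel_measurable borel"
  unfolding d_eps_def[abs_def] using borel_measurable_hsetdist[OF Compl_D] by measurable

end

locale play = tug_of_war +
  fixes q0 :: heis and \<sigma>I \<sigma>II :: strategy
  assumes \<sigma>I: "\<sigma>I \<in> strategies" and \<sigma>II: "\<sigma>II \<in> strategies"
begin

sublocale P: prob_space Omega by (rule prob_space_Omega)

abbreviation "pos \<equiv> position p \<epsilon> q0 \<sigma>I \<sigma>II"

text \<open>\<open>restrict\<close> unfolds to the conditional with default \<open>undefined\<close>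
  used in \<open>position\<close>, so the two histories coincide.\<close>

definition hist :: "(nat \<Rightarrow> outcome) \<Rightarrow> nat \<Rightarrow> history" where
  "hist \<omega> n = (q0, restrict (\<lambda>i. (pos \<omega> i, \<omega> i)) {1..n})"

lemma pos_Suc:
  "pos \<omega> (Suc n) = next_pos g \<epsilon> (pos \<omega> n) (\<sigma>I n (hist \<omega> n)) (\<sigma>II n (hist \<omega> n)) (\<omega> (Suc n))"
  by (simp add: next_pos_def hist_def restrict_def Let_def split_beta cong: if_cong)

declare position.simps(2) [simp del]

text \<open>Non-anticipation. The induction is strong because a move may depend on all earlier
  positions.\<close>

lemma pos_cong:
  assumes "\<And>i. 1 \<le> i \<Longrightarrow> i \<le> n \<Longrightarrow> \<omega>' i = \<omega> i" and "k \<le> n"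
  shows "pos \<omega>' k = pos \<omega> k"
  using assms(2)
proof (induction k rule: less_induct)
  case (less k)
  show ?case
  proof (cases k)
    case (Suc m)
    have "hist \<omega>' m = hist \<omega> m"
      unfolding hist_def
    proof (intro arg_cong2[where f = Pair] refl restrict_ext)
      fix i assume "i \<in> {1..m}"
      then show "pos \<omega>' i = pos \<omega> i" "\<omega>' i = \<omega> i"
        using less.IH[of i] less.prems Suc assms(1)[of i] by auto
    qed
    then show ?thesis using less.IH[of m] less.prems Suc assms(1)[of k] by (simp add: pos_Suc)
  qed simp
qed

lemma pos_upd: "k \<le> n \<Longrightarrow> pos (fun_upd \<omega> (Suc n) a) k = pos \<omega> k"
  by (rule pos_cong[where n = n]) auto

lemma hist_upd: "k \<le> n \<Longrightarrow> hist (fun_upd \<omega> (Suc n) a) k = hist \<omega> k"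
  unfolding hist_def
  by (intro arg_cong2[where f = Pair] refl restrict_ext) (auto simp del: fun_upd_apply simp: pos_upd fun_upd_other)

text \<open>Histories are built from positions, and the next position from moves chosen on the
  history; the induction runs over positions and passes through the history at each stage.\<close>

lemma pos_hist_measurable:
  shows pos_measurable [measurable]: "(\<lambda>\<omega>. pos \<omega> n) \<in> borel_measurable Omega"
    and hist_measurable [measurable]: "(\<lambda>\<omega>. hist \<omega> n) \<in> Omega \<rightarrow>\<^sub>M Hist n"
proof -
  have hist: "(\<lambda>\<omega>. hist \<omega> n) \<in> Omega \<rightarrow>\<^sub>M Hist n"
    if "\<And>i. i \<le> n \<Longrightarrow> (\<lambda>\<omega>. pos \<omega> i) \<in> borel_measurable Omega" for n
    unfolding hist_def Hist_def
    by (intro measurable_Pair measurable_restrict measurable_const measurable_Omega_component that) auto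
  have str: "(\<lambda>\<omega>. \<sigma> n (hist \<omega> n)) \<in> borel_measurable Omega"
    if "(\<lambda>\<omega>. hist \<omega> n) \<in> Omega \<rightarrow>\<^sub>M Hist n" "\<sigma> \<in> strategies" for \<sigma> n
    using measurable_compose[OF that(1), of "\<sigma> n" "restrict_space borel (hball 0 1)"] that(2)
    by (auto simp: strategies_def measurable_restrict_space2_iff)
  show *: "(\<lambda>\<omega>. pos \<omega> n) \<in> borel_measurable Omega" for n
  proof (induction n rule: less_induct)
    case (less n)
    show ?case
    proof (cases n)
      case (Suc m)
      have h: "(\<lambda>\<omega>. hist \<omega> m) \<in> Omega \<rightarrow>\<^sub>M Hist m"
        by (rule hist) (rule less.IH, simp add: Suc)
      have [measurable]: "(\<lambda>\<omega>. pos \<omega> m) \<in> borel_measurable Omega"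
        by (rule less.IH) (simp add: Suc)
      note [measurable] = str[OF h \<sigma>I] str[OF h \<sigma>II]
      show ?thesis unfolding Suc pos_Suc by measurable
    qed simp
  qed
  show "(\<lambda>\<omega>. hist \<omega> n) \<in> Omega \<rightarrow>\<^sub>M Hist n"
    by (rule hist) (rule *)
qed

lemma move_measurable [measurable]:
  "(\<lambda>\<omega>. \<sigma>I n (hist \<omega> n)) \<in> borel_measurable Omega"
  "(\<lambda>\<omega>. \<sigma>II n (hist \<omega> n)) \<in> borel_measurable Omega"
  and move_mem_hball:
  "\<omega> \<in> space Omega \<Longrightarrow> \<sigma>I n (hist \<omega> n) \<in> hball 0 1"
  "\<omega> \<in> space Omega \<Longrightarrow> \<sigma>II n (hist \<omega> n) \<in> hball 0 1"
proof -
  have *: "(\<lambda>\<omega>. \<sigma> n (hist \<omega> n)) \<in> Omega \<rightarrow>\<^sub>M restrict_space borel (hball 0 1)"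
    if "\<sigma> \<in> strategies" for \<sigma>
    using that by (auto simp: strategies_def intro: measurable_compose[OF hist_measurable])
  note * = *[OF \<sigma>I] *[OF \<sigma>II]
  show "(\<lambda>\<omega>. \<sigma>I n (hist \<omega> n)) \<in> borel_measurable Omega"
    "(\<lambda>\<omega>. \<sigma>II n (hist \<omega> n)) \<in> borel_measurable Omega"
    using * by (auto simp: measurable_restrict_space2_iff)
  show "\<omega> \<in> space Omega \<Longrightarrow> \<sigma>I n (hist \<omega> n) \<in> hball 0 1"
    "\<omega> \<in> space Omega \<Longrightarrow> \<sigma>II n (hist \<omega> n) \<in> hball 0 1"
    using *[THEN measurable_space, of \<omega>] by (auto simp: space_restrict_space)
qed

section \<open>Survival, stopping time and final position\<close>

definition alive :: "(nat \<Rightarrow> outcome) \<Rightarrow> nat \<Rightarrow> bool" where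
  "alive \<omega> n \<longleftrightarrow> (\<forall>k<n. snd (snd (\<omega> (Suc k))) \<le> d (pos \<omega> k))"

lemma alive_0 [simp]: "alive \<omega> 0"
  by (simp add: alive_def)

lemma alive_Suc: "alive \<omega> (Suc n) \<longleftrightarrow> alive \<omega> n \<and> snd (snd (\<omega> (Suc n))) \<le> d (pos \<omega> n)"
  by (auto simp: alive_def less_Suc_eq)

lemma alive_upd: "k \<le> n \<Longrightarrow> alive (fun_upd \<omega> (Suc n) a) k = alive \<omega> k"
  by (auto simp: alive_def pos_upd)

lemma stop_measurable [measurable]:
  "stop p D \<epsilon> q0 \<sigma>I \<sigma>II \<in> Omega \<rightarrow>\<^sub>M count_space UNIV"
proof -
  have "Measurable.pred Omega (\<lambda>\<omega>. 1 \<le> n \<and> d (pos \<omega> (n - 1)) < snd (snd (\<omega> n)))" for n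
  proof (cases n)
    case (Suc m)
    have "Measurable.pred Omega (\<lambda>\<omega>. d (pos \<omega> m) < snd (snd (\<omega> (Suc m))))" by measurable
    then show ?thesis by (simp add: Suc)
  qed simp
  then show ?thesis
    unfolding stop_def[abs_def] by (rule measurable_Least)
qed

lemma alive_measurable [measurable]: "Measurable.pred Omega (\<lambda>\<omega>. alive \<omega> n)"
proof (induction n)
  case (Suc n)
  note [measurable] = Suc.IH
  have "Measurable.pred Omega (\<lambda>\<omega>. alive \<omega> n \<and> \<not> d (pos \<omega> n) < snd (snd (\<omega> (Suc n))))"
    by measurable
  then show ?case by (simp add: alive_Suc not_less)
qed simp

text \<open>The test in round \<open>n + 1\<close> uses the threshold at position \<open>n\<close>.
  If it is the first to stop the game, the payoff is collected at
  \<open>stop - 1 = n\<close>.\<close>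

lemma stop_eq_Suc: "alive \<omega> n \<Longrightarrow> \<not> alive \<omega> (Suc n) \<Longrightarrow> stop p D \<epsilon> q0 \<sigma>I \<sigma>II \<omega> = Suc n"
  unfolding stop_def
proof (rule Least_equality)
  assume *: "alive \<omega> n" "\<not> alive \<omega> (Suc n)"
  then show "1 \<le> Suc n \<and> d (pos \<omega> (Suc n - 1)) < snd (snd (\<omega> (Suc n)))"
    by (auto simp: alive_Suc)
  fix m assume m: "1 \<le> m \<and> d (pos \<omega> (m - 1)) < snd (snd (\<omega> m))"
  show "Suc n \<le> m"
  proof (rule ccontr)
    assume "\<not> Suc n \<le> m"
    then have "m - 1 < n" "Suc (m - 1) = m" using m by auto
    then show False using *(1) m unfolding alive_def by (metis not_le)
  qed
qed

text \<open>On a path that survives every test this is whatever \<open>LEAST\<close> selects; the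
  estimates there use only the bound on \<open>F\<close>.\<close>

definition final :: "(nat \<Rightarrow> outcome) \<Rightarrow> heis" where
  "final \<omega> = pos \<omega> (stop p D \<epsilon> q0 \<sigma>I \<sigma>II \<omega> - 1)"

lemma final_measurable [measurable]: "final \<in> borel_measurable Omega"
proof -
  have "(\<lambda>\<omega>. (\<lambda>n \<omega>. pos \<omega> (n - 1)) (stop p D \<epsilon> q0 \<sigma>I \<sigma>II \<omega>) \<omega>) \<in> borel_measurable Omega"
    by (rule measurable_compose_countable[OF _ stop_measurable]) measurable
  then show ?thesis by (simp add: final_def[abs_def])
qed

text \<open>Interpolates between \<open>v q0\<close> at \<open>n = 0\<close> and the true payoff for
  large \<open>n\<close>. Although it mentions the actual stopping time, that time is at most
  \<open>n\<close> as soon as the game is no longer alive.\<close>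

definition truncated :: "(heis \<Rightarrow> real) \<Rightarrow> (heis \<Rightarrow> real) \<Rightarrow> nat \<Rightarrow> (nat \<Rightarrow> outcome) \<Rightarrow> real" where
  "truncated v F n \<omega> = (if alive \<omega> n then v (pos \<omega> n) else F (final \<omega>))"

text \<open>On survival, the conditional expectation of the next \<open>truncated\<close> value
  given the first \<open>n\<close> rounds.\<close>

definition moves_op :: "(heis \<Rightarrow> real) \<Rightarrow> (heis \<Rightarrow> real) \<Rightarrow> nat \<Rightarrow> (nat \<Rightarrow> outcome) \<Rightarrow> real" where
  "moves_op v F n \<omega> = dpp_op v F (pos \<omega> n) (\<sigma>I n (hist \<omega> n)) (\<sigma>II n (hist \<omega> n))"

text \<open>The tail of the stopping time; its sum is the expected duration.\<close>

definition alive_prob :: "nat \<Rightarrow> real" where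
  "alive_prob n = (\<integral>\<omega>. of_bool (alive \<omega> n) \<partial>Omega)"

lemma integrable_bounded:
  fixes f :: "(nat \<Rightarrow> outcome) \<Rightarrow> real"
  assumes "f \<in> borel_measurable Omega" "\<And>\<omega>. \<bar>f \<omega>\<bar> \<le> B"
  shows "integrable Omega f"
  by (rule P.integrable_const_bound[where B = B]) (use assms in auto)

lemma integrable_alive [simp]: "integrable Omega (\<lambda>\<omega>. of_bool (alive \<omega> n) :: real)"
  by (rule integrable_bounded[where B = 1]) (auto simp: of_bool_def)

lemma alive_prob_nonneg: "0 \<le> alive_prob n"
  unfolding alive_prob_def by (rule Bochner_Integration.integral_nonneg) auto

context
  fixes v F :: "heis \<Rightarrow> real" and B :: real
  assumes v [measurable]: "v \<in> borel_measurable borel" and vB: "\<And>q. \<bar>v q\<bar> \<le> B"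
    and F [measurable]: "F \<in> borel_measurable borel" and FB: "\<And>q. \<bar>F q\<bar> \<le> B"
begin

lemma integrable_truncated: "integrable Omega (truncated v F n)"
proof (rule integrable_bounded)
  show "truncated v F n \<in> borel_measurable Omega"
    unfolding truncated_def[abs_def] by measurable
  show "\<bar>truncated v F n \<omega>\<bar> \<le> B" for \<omega>
    using vB[of "pos \<omega> n"] FB[of "final \<omega>"] by (simp add: truncated_def)
qed

text \<open>The increment vanishes unless the game is alive after \<open>n\<close> rounds. Position
  and moves at time \<open>n\<close> ignore outcome \<open>n + 1\<close>, so integrating that
  outcome alone yields the one-round average.\<close>

lemma integral_truncated_step:
  shows "integral\<^sup>L Omega (truncated v F (Suc n)) - integral\<^sup>L Omega (truncated v F n) =
      (\<integral>\<omega>. of_bool (alive \<omega> n) * (moves_op v F n \<omega> - v (pos \<omega> n)) \<partial>Omega)" (is ?step)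
    and "integrable Omega (\<lambda>\<omega>. of_bool (alive \<omega> n) * (moves_op v F n \<omega> - v (pos \<omega> n)))" (is ?int)
proof -
  interpret O1: prob_space Omega1 by (rule prob_space_Omega1)
  \<comment> \<open>The increment with the stopped payoff written as
    \<open>F (pos \<omega> n)\<close> instead of \<open>F (final \<omega>)\<close>: it reads
    outcomes only up to \<open>Suc n\<close>, so the effect of overwriting the last of them is
    explicit.\<close>
  define f :: "(nat \<Rightarrow> outcome) \<Rightarrow> real" where
    "f \<omega> = of_bool (alive \<omega> n) *
      ((if snd (snd (\<omega> (Suc n))) \<le> d (pos \<omega> n) then v (pos \<omega> (Suc n)) else F (pos \<omega> n)) - v (pos \<omega> n))" for \<omega>
  have diff: "truncated v F (Suc n) \<omega> - truncated v F n \<omega> = f \<omega>" for \<omega>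
    using stop_eq_Suc[of \<omega> n] by (auto simp: truncated_def f_def alive_Suc final_def)
  have f [measurable]: "f \<in> borel_measurable Omega"
    unfolding f_def by measurable
  have fB: "\<bar>f \<omega>\<bar> \<le> 2 * B" for \<omega>
    using vB[of "pos \<omega> n"] vB[of "pos \<omega> (Suc n)"] FB[of "pos \<omega> n"]
    by (auto simp: f_def)
  have inner: "(\<integral>a. f (fun_upd \<omega> (Suc n) a) \<partial>Omega1) =
      of_bool (alive \<omega> n) * (moves_op v F n \<omega> - v (pos \<omega> n))" for \<omega>
  proof -
    let ?q = "pos \<omega> n"
    let ?k = "\<lambda>a. if snd (snd a) \<le> d ?q
      then v (next_pos g \<epsilon> ?q (\<sigma>I n (hist \<omega> n)) (\<sigma>II n (hist \<omega> n)) a) else F ?q"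
    have id [measurable]: "(\<lambda>a. a) \<in> Omega1 \<rightarrow>\<^sub>M Omega1" by simp
    have "?k \<in> borel_measurable Omega1" by measurable
    then have k: "integrable Omega1 ?k"
      by (rule O1.integrable_const_bound[where B = B, rotated]) (use vB FB in auto)
    have "f (fun_upd \<omega> (Suc n) a) = of_bool (alive \<omega> n) * (?k a - v ?q)" for a
      by (simp add: f_def alive_upd pos_upd hist_upd pos_Suc)
    then have "(\<integral>a. f (fun_upd \<omega> (Suc n) a) \<partial>Omega1) =
        of_bool (alive \<omega> n) * ((\<integral>a. ?k a \<partial>Omega1) - v ?q)"
      using k O1.prob_space by simp
    also have "(\<integral>a. ?k a \<partial>Omega1) = moves_op v F n \<omega>"
      unfolding moves_op_def dpp_op_def
      by (rule integral_Omega1_step[OF v vB d_nonneg d_le_1 eps_pos])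
    finally show ?thesis .
  qed
  have "integral\<^sup>L Omega (truncated v F (Suc n)) - integral\<^sup>L Omega (truncated v F n) = integral\<^sup>L Omega f"
    by (subst Bochner_Integration.integral_diff[symmetric]) (simp_all add: integrable_truncated diff)
  also have "\<dots> = (\<integral>\<omega>. of_bool (alive \<omega> n) * (moves_op v F n \<omega> - v (pos \<omega> n)) \<partial>Omega)"
    by (subst integral_Omega_resample(1)[OF f fB, of "Suc n"]) (simp_all add: inner)
  finally show ?step .
  have "\<bar>\<integral>a. f (fun_upd \<omega> (Suc n) a) \<partial>Omega1\<bar> \<le> 2 * B" for \<omega>
    using fB by (rule O1.abs_expectation_le)
  with integral_Omega_resample(2)[OF f fB, of "Suc n"] show ?int
    by (intro integrable_bounded[where B = "2 * B"]) (simp_all only: inner)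
qed

text \<open>Telescoping of the one-round differences. A negative \<open>\<eta>\<close> is allowed,
  and that case produces the duration bound.\<close>

lemma integral_truncated_le:
  assumes le: "\<And>n \<omega>. \<omega> \<in> space Omega \<Longrightarrow> moves_op v F n \<omega> \<le> v (pos \<omega> n) + \<eta>"
  shows "integral\<^sup>L Omega (truncated v F n) \<le> v q0 + \<eta> * (\<Sum>k<n. alive_prob k)"
proof (induction n)
  case 0
  show ?case using P.prob_space by (simp add: truncated_def)
next
  case (Suc n)
  have "(\<integral>\<omega>. of_bool (alive \<omega> n) * (moves_op v F n \<omega> - v (pos \<omega> n)) \<partial>Omega)
      \<le> (\<integral>\<omega>. \<eta> * of_bool (alive \<omega> n) \<partial>Omega)"
    using le by (intro Bochner_Integration.integral_mono integral_truncated_step(2) integrable_mult_right integrable_alive)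
      (auto simp: algebra_simps)
  also have "\<dots> = \<eta> * alive_prob n"
    by (simp add: alive_prob_def)
  finally show ?case
    using Suc integral_truncated_step(1)[of n] by (simp add: algebra_simps)
qed

text \<open>Payoff and truncation differ only on paths alive at time \<open>n\<close>, and there by
  at most \<open>2 * B\<close>.\<close>

lemma expected_payoff_le_truncated:
  "expected_payoff p D F \<epsilon> q0 \<sigma>I \<sigma>II \<le> integral\<^sup>L Omega (truncated v F n) + 2 * B * alive_prob n"
proof -
  have "integral\<^sup>L Omega (\<lambda>\<omega>. F (final \<omega>)) \<le>
      integral\<^sup>L Omega (\<lambda>\<omega>. truncated v F n \<omega> + 2 * B * of_bool (alive \<omega> n))"
  proof (rule Bochner_Integration.integral_mono)
    show "integrable Omega (\<lambda>\<omega>. F (final \<omega>))"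
      by (rule integrable_bounded) (measurable, rule FB)
    show "integrable Omega (\<lambda>\<omega>. truncated v F n \<omega> + 2 * B * of_bool (alive \<omega> n))"
      by (intro Bochner_Integration.integrable_add integrable_truncated integrable_mult_right) simp
    show "F (final \<omega>) \<le> truncated v F n \<omega> + 2 * B * of_bool (alive \<omega> n)" for \<omega>
      using vB[of "pos \<omega> n"] FB[of "final \<omega>"] by (auto simp: truncated_def)
  qed
  also have "\<dots> = integral\<^sup>L Omega (truncated v F n) + 2 * B * alive_prob n"
    by (subst Bochner_Integration.integral_add)
      (auto simp: alive_prob_def integrable_truncated)
  finally show ?thesis by (simp add: expected_payoff_def final_def)
qed

end

text \<open>\<open>h\<close> is a Lyapunov function: each round begun alive costs at least
  \<open>c\<close> in expectation, and nonnegativity caps the total cost by the initial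
  value.\<close>

lemma sum_alive_prob_le:
  assumes h [measurable]: "h \<in> borel_measurable borel" and B: "\<And>q. 0 \<le> h q" "\<And>q. h q \<le> B"
    and drift: "\<And>q x y. x \<in> hball 0 1 \<Longrightarrow> y \<in> hball 0 1 \<Longrightarrow> dpp_op h (\<lambda>_. 0) q x y \<le> h q - c"
  shows "c * (\<Sum>k<n. alive_prob k) \<le> h q0"
proof -
  have h': "\<bar>h q\<bar> \<le> B" for q using B[of q] by simp
  have 0: "\<bar>0 :: real\<bar> \<le> B" for q :: heis using h'[of q] by linarith
  have "0 \<le> integral\<^sup>L Omega (truncated h (\<lambda>_. 0) n)"
    by (rule Bochner_Integration.integral_nonneg) (simp add: truncated_def B)
  also have "\<dots> \<le> h q0 + (- c) * (\<Sum>k<n. alive_prob k)"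
    by (rule integral_truncated_le[OF h h' _ 0])
      (use drift move_mem_hball in \<open>auto simp: moves_op_def\<close>)
  finally show ?thesis by simp
qed

text \<open>Summable tails tend to 0, which removes the truncation error in the limit, while their
  sum caps the accumulated one-round errors.\<close>

lemma expected_payoff_le:
  assumes "v \<in> borel_measurable borel" "\<And>q. \<bar>v q\<bar> \<le> B"
    and "F \<in> borel_measurable borel" "\<And>q. \<bar>F q\<bar> \<le> B"
    and le: "\<And>n \<omega>. \<omega> \<in> space Omega \<Longrightarrow> moves_op v F n \<omega> \<le> v (pos \<omega> n) + \<eta>" and \<eta>: "0 \<le> \<eta>"
    and S: "\<And>n. (\<Sum>k<n. alive_prob k) \<le> S"
  shows "expected_payoff p D F \<epsilon> q0 \<sigma>I \<sigma>II \<le> v q0 + \<eta> * S"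
proof (rule LIMSEQ_le_const)
  have "summable alive_prob"
    using S alive_prob_nonneg by (intro summableI_nonneg_bounded)
  then have "alive_prob \<longlonglongrightarrow> 0" by (rule summable_LIMSEQ_zero)
  then show "(\<lambda>n. v q0 + \<eta> * S + 2 * B * alive_prob n) \<longlonglongrightarrow> v q0 + \<eta> * S"
    by (auto intro!: tendsto_eq_intros)
  have "expected_payoff p D F \<epsilon> q0 \<sigma>I \<sigma>II \<le> v q0 + \<eta> * S + 2 * B * alive_prob n" for n
    using expected_payoff_le_truncated[OF assms(1-4), of n] integral_truncated_le[OF assms(1-4) le, of n]
      mult_left_mono[OF S \<eta>, of n] by linarith
  then show "\<exists>N. \<forall>n\<ge>N. expected_payoff p D F \<epsilon> q0 \<sigma>I \<sigma>II \<le> v q0 + \<eta> * S + 2 * B * alive_prob n"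
    by blast
qed

end

subsection \<open>Finite expected duration\<close>

text \<open>The 6 is a doubling times the three faces of the coin. The noise has positive mass on
  \<open>1 / 2 < fst w\<close>, where the exponential can be made as large as desired.\<close>

lemma noise_exponential_moment:
  assumes \<epsilon>: "0 < \<epsilon>"
  obtains a where "0 \<le> a" "6 \<le> (\<integral>w. exp (a * (\<epsilon> * fst w)) \<partial>noise)"
proof -
  interpret N: prob_space noise by (rule prob_space_noise)
  define S :: "heis set" where "S = {w. 1 / 2 < fst w}"
  have oS: "open S" unfolding S_def by (intro open_Collect_less continuous_intros)
  then have [measurable]: "S \<in> sets borel" by simp
  define m where "m = (\<integral>w. indicator S w \<partial>noise :: real)"
  have [measurable]: "(\<lambda>w. w) \<in> borel_measurable noise"
    by (rule measurable_noise_borel) simp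
  have Si: "integrable noise (indicator S :: heis \<Rightarrow> real)"
    by (rule N.integrable_const_bound[where B = 1]) (auto simp: indicator_def)
  have "m = 1 / measure lborel (hball 0 1) * (LINT w:hball 0 1|lborel. indicator S w)"
    unfolding m_def by (rule integral_noise) simp
  also have "(LINT w:hball 0 1|lborel. indicator S w :: real) = measure lborel (hball 0 1 \<inter> S)"
    by (simp add: set_lebesgue_integral_def indicator_inter_arith[symmetric])
  finally have m_eq: "m = measure lborel (hball 0 1 \<inter> S) / measure lborel (hball 0 1)"
    by simp
  \<comment> \<open>A witness that the ball meets the half-space \<open>S\<close>: its gauge is
    3/4.\<close>
  have "koranyi (3/4, 0, 0) < 1"
    unfolding koranyi.simps by (subst real_root_lt_1_iff) (auto simp: power2_eq_square)
  then have "(3/4, 0, 0) \<in> hball 0 1 \<inter> S"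
    by (simp add: S_def mem_hball_zero)
  then have "0 < emeasure lborel (hball 0 1 \<inter> S)"
    by (intro emeasure_lborel_open_pos open_Int open_hball oS) auto
  moreover have "emeasure lborel (hball 0 1 \<inter> S) < \<infinity>"
    by (intro emeasure_bounded_finite bounded_Int) (simp add: bounded_unit_hball)
  ultimately have m0: "0 < m"
    unfolding m_eq by (intro divide_pos_pos measure_unit_hball_pos) (simp add: measure_def enn2real_positive_iff)
  have m1: "m \<le> 1"
    unfolding m_def by (rule N.integral_le_const[OF Si]) (simp add: indicator_def)
  \<comment> \<open>Solves \<open>exp (a * \<epsilon> / 2) * m = 6\<close>; it is nonnegative since
    \<open>m \<le> 1\<close>.\<close>
  define a where "a = 2 * ln (6 / m) / \<epsilon>"
  have a: "0 \<le> a" using m0 m1 \<epsilon> by (auto simp: a_def field_simps)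
  have bnd: "\<bar>exp (a * (\<epsilon> * fst w))\<bar> \<le> exp (a * \<epsilon>)" if "w \<in> hball 0 1" for w
    using unit_hball_bounds(1)[OF that] a \<epsilon> mult_left_le[of "fst w" "a * \<epsilon>"] by (simp add: mult.assoc)
  have "6 = exp (a * (\<epsilon> * (1/2))) * m"
    using m0 \<epsilon> by (simp add: a_def)
  also have "\<dots> = (\<integral>w. exp (a * (\<epsilon> * (1/2))) * indicator S w \<partial>noise)"
    unfolding m_def by simp
  also have "\<dots> \<le> (\<integral>w. exp (a * (\<epsilon> * fst w)) \<partial>noise)"
  proof (rule Bochner_Integration.integral_mono)
    show "integrable noise (\<lambda>w. exp (a * (\<epsilon> * (1/2))) * indicator S w)"
      using Si by (intro integrable_mult_right)
    show "integrable noise (\<lambda>w. exp (a * (\<epsilon> * fst w)))"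
    proof (rule N.integrable_const_bound)
      show "AE w in noise. norm (exp (a * (\<epsilon> * fst w))) \<le> exp (a * \<epsilon>)"
        using bnd by (intro AE_I2) (simp only: real_norm_def space_noise)
      show "(\<lambda>w. exp (a * (\<epsilon> * fst w))) \<in> borel_measurable noise"
        by (rule measurable_compose[OF measurable_noise_borel borel_measurable_continuous_onI])
          (auto intro!: continuous_intros)
    qed
    show "exp (a * (\<epsilon> * (1/2))) * indicator S w \<le> exp (a * (\<epsilon> * fst w))" for w :: heis
    proof (cases "w \<in> S")
      case True
      then have "a * (\<epsilon> * (1/2)) \<le> a * (\<epsilon> * fst w)"
        using a \<epsilon> by (intro mult_left_mono) (auto simp: S_def)
      then show ?thesis using True by simp
    qed simp
  qed
  finally show thesis using a that by blast
qed

context tug_of_war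
begin

text \<open>The noise alone multiplies \<open>exp (a x)\<close> by at least 6 in expectation, so a third of the
  rounds already doubles it, whatever the players do: a bounded function decreasing in
  \<open>exp (a x)\<close> has strictly negative drift inside \<open>D\<close>.\<close>

lemma drift_function:
  "\<exists>c h E. 0 < c \<and> h \<in> borel_measurable borel \<and> (\<forall>q. 0 \<le> h q \<and> h q \<le> E) \<and>
    (\<forall>q. \<forall>x\<in>hball 0 1. \<forall>y\<in>hball 0 1. dpp_op h (\<lambda>_. 0) q x y \<le> h q - c)"
proof -
  interpret N: prob_space noise by (rule prob_space_noise)
  have [measurable]: "(\<lambda>w. w) \<in> borel_measurable noise"
    by (rule measurable_noise_borel) simp
  obtain a where a: "0 \<le> a" and M: "6 \<le> (\<integral>w. exp (a * (\<epsilon> * fst w)) \<partial>noise)"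
    using noise_exponential_moment[OF eps_pos] .
  obtain R0 where R0: "\<And>q. q \<in> D \<Longrightarrow> norm q \<le> R0"
    using bounded_D by (auto simp: bounded_iff)
  define R where "R = max 0 R0"
  have R: "\<bar>fst q\<bar> \<le> R" if "q \<in> D" for q
    using norm_fst_le[of "fst q" "snd q"] R0[OF that] by (simp add: R_def)
  \<comment> \<open>The cap keeps \<open>h\<close> bounded, yet is high enough that a pure noise
    step from \<open>D\<close> stays below it.\<close>
  define K where "K = R + \<bar>g\<bar> + \<epsilon>"
  \<comment> \<open>The extra 1 gives \<open>h \<ge> 1 \<ge> c\<close>, which handles both the
    factor \<open>d q\<close> and the positions outside \<open>D\<close>.\<close>
  define E where "E = exp (a * K) + 1"
  define h where "h q = E - exp (a * min (fst q) K)" for q :: heis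
  define c where "c = exp (- (a * R))"
  have c1: "c \<le> 1" using a by (simp add: c_def R_def)
  have hm [measurable]: "h \<in> borel_measurable borel"
    unfolding h_def by (intro borel_measurable_continuous_onI continuous_intros)
  have h1: "1 \<le> h q" and hE: "h q \<le> E" for q
    using a mult_left_mono[of "min (fst q) K" K a] by (simp_all add: h_def E_def)
  have h_abs: "\<bar>h q\<bar> \<le> E" for q using h1[of q] hE[of q] by simp
  have A_le: "A3 h \<epsilon> z \<le> E" for z
    using N.abs_expectation_le[of "\<lambda>w. h (z \<star> dil \<epsilon> w)" E] h_abs
    by (simp add: A3_eq_noise[OF hm eps_pos])
  have A_q: "A3 h \<epsilon> q \<le> E - 6 * exp (a * fst q)" if q: "q \<in> D" for q
  proof -
    \<comment> \<open>An integral of at least 6 cannot be the default value 0 of a non-integrable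
      function.\<close>
    have "integrable noise (\<lambda>w. exp (a * (\<epsilon> * fst w)))"
      using M not_integrable_integral_eq[of noise "\<lambda>w. exp (a * (\<epsilon> * fst w))"] by fastforce
    then have i: "integrable noise (\<lambda>w. exp (a * fst q) * exp (a * (\<epsilon> * fst w)))"
      by (rule integrable_mult_right)
    have "A3 h \<epsilon> q = (\<integral>w. E - exp (a * fst q) * exp (a * (\<epsilon> * fst w)) \<partial>noise)"
      unfolding A3_eq_noise[OF hm eps_pos]
    proof (rule Bochner_Integration.integral_cong[OF refl])
      fix w assume "w \<in> space noise"
      then have "fst w < 1" using unit_hball_bounds(1)[of w] by simp
      then have "\<epsilon> * fst w \<le> \<epsilon>"
        using eps_pos mult_left_mono[of "fst w" 1 \<epsilon>] by simp
      then have "fst q + \<epsilon> * fst w \<le> K"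
        using R[OF q] unfolding K_def by linarith
      then show "h (q \<star> dil \<epsilon> w) = E - exp (a * fst q) * exp (a * (\<epsilon> * fst w))"
        by (simp add: h_def hmul_eq dil_eq min_def exp_add[symmetric] algebra_simps)
    qed
    also have "\<dots> = E - exp (a * fst q) * (\<integral>w. exp (a * (\<epsilon> * fst w)) \<partial>noise)"
      using i N.prob_space by (subst Bochner_Integration.integral_diff) simp_all
    also have "\<dots> \<le> E - exp (a * fst q) * 6"
      using M by (intro diff_left_mono mult_left_mono) auto
    finally show ?thesis by simp
  qed
  have "dpp_op h (\<lambda>_. 0) q x y \<le> h q - c" for q x y
  proof (cases "q \<in> D")
    case True
    have "fst q \<le> K"
      using R[OF True] eps_pos unfolding K_def by linarith
    then have "h q = E - exp (a * fst q)"
      by (simp add: h_def)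
    moreover have "c \<le> exp (a * fst q)"
      using R[OF True] a mult_left_mono[of "- R" "fst q" a] by (simp add: c_def)
    \<comment> \<open>A third of \<open>6 * exp (a * fst q)\<close> is twice the exponential in
      \<open>h q\<close>. The surplus copy is at least \<open>c\<close>.\<close>
    ultimately have avg: "1/3 * A3 h \<epsilon> q + 1/3 * A3 h \<epsilon> (q \<star> dil g x) + 1/3 * A3 h \<epsilon> (q \<star> dil g y) \<le> h q - c"
      using A_q[OF True] A_le[of "q \<star> dil g x"] A_le[of "q \<star> dil g y"] by simp
    have "dpp_op h (\<lambda>_. 0) q x y \<le> d q * (h q - c)"
      unfolding dpp_op_def using mult_left_mono[OF avg d_nonneg[of q]] by simp
    also have "\<dots> \<le> h q - c"
      using h1[of q] c1 d_le_1[of q] d_nonneg[of q] by (intro mult_left_le_one_le) auto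
    finally show ?thesis .
  next
    case False
    then show ?thesis using h1[of q] c1 by (simp add: dpp_op_def d_outside)
  qed
  moreover have "0 < c" by (simp add: c_def)
  moreover have "0 \<le> h q" for q using h1[of q] by simp
  ultimately show ?thesis using hm hE by blast
qed

end

subsection \<open>Near-optimal stationary strategies\<close>

text \<open>In noise form only the integrand moves with the centre, and the constant
  \<open>B\<close> dominates it.\<close>

lemma continuous_on_A3:
  assumes v: "continuous_on UNIV v" and B: "\<And>q. \<bar>v q\<bar> \<le> B" and r: "0 < r"
  shows "continuous_on UNIV (A3 v r)"
  unfolding continuous_on_sequentially
proof (intro allI ballI impI, elim conjE)
  fix X :: "nat \<Rightarrow> heis" and q assume X: "X \<longlonglongrightarrow> q"
  interpret N: prob_space noise by (rule prob_space_noise)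
  have vm [measurable]: "v \<in> borel_measurable borel"
    using v by (rule borel_measurable_continuous_onI)
  have [measurable]: "(\<lambda>w. w) \<in> borel_measurable noise"
    by (rule measurable_noise_borel) simp
  have "(\<lambda>n. \<integral>w. v (X n \<star> dil r w) \<partial>noise) \<longlonglongrightarrow> (\<integral>w. v (q \<star> dil r w) \<partial>noise)"
  proof (rule integral_dominated_convergence[where w = "\<lambda>_. B"])
    have "(\<lambda>n. v (X n \<star> dil r w)) \<longlonglongrightarrow> v (q \<star> dil r w)" for w
    proof (rule continuous_on_tendsto_compose[of UNIV "\<lambda>q. v (q \<star> dil r w)", OF _ X])
      show "continuous_on UNIV (\<lambda>q. v (q \<star> dil r w))"
        by (rule continuous_on_compose2[OF v]) (auto intro!: continuous_intros)
    qed auto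
    then show "AE w in noise. (\<lambda>n. v (X n \<star> dil r w)) \<longlonglongrightarrow> v (q \<star> dil r w)" by simp
  qed (use B in auto)
  then show "(A3 v r \<circ> X) \<longlonglongrightarrow> A3 v r q"
    by (simp add: A3_eq_noise[OF vm r] comp_def)
qed

text \<open>The infimum over the open ball need not be attained. Taking the first acceptable member
  of a countable dense set involves only countably many measurable comparisons.\<close>

lemma measurable_near_optimal_move:
  fixes f :: "heis \<Rightarrow> real"
  assumes f: "continuous_on UNIV f" and B: "\<And>q. \<bar>f q\<bar> \<le> B" and r: "0 < r" and \<eta>: "0 < \<eta>"
  shows "\<exists>s\<in>borel_measurable borel. \<forall>q. s q \<in> hball 0 1 \<and>
    f (q \<star> dil r (s q)) < (INF q'\<in>hball q r. f q') + \<eta>"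
proof -
  define I where "I q = (INF q'\<in>hball q r. f q')" for q
  have I_eq: "I q = (INF w\<in>hball 0 1. f (q \<star> dil r w))" for q
    unfolding I_def hball_eq_image[OF r] by (simp add: image_image)
  have ne: "hball 0 1 \<noteq> {}" using unit_hball_nonempty by blast
  have bdd: "bdd_below ((\<lambda>w. f (q \<star> dil r w)) ` hball 0 1)" for q
    using B by (intro bdd_belowI2[where m = "- B"]) (simp add: abs_le_iff minus_le_iff)
  have cont: "continuous_on UNIV (\<lambda>q. f (q \<star> dil r w))" "continuous_on UNIV (\<lambda>w. f (q \<star> dil r w))" for q w
    by (rule continuous_on_compose2[OF f]; auto intro!: continuous_intros)+
  have I_less: "I q < b \<longleftrightarrow> (\<exists>w\<in>hball 0 1. f (q \<star> dil r w) < b)" for q b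
    unfolding I_eq by (rule cINF_less_iff[OF ne bdd])
  have [measurable]: "I \<in> borel_measurable borel"
    unfolding borel_measurable_iff_less
  proof
    fix b
    \<comment> \<open>Upper semicontinuity again: the infimum is now over moves from the fixed unit
      ball.\<close>
    have "{q. I q < b} = (\<Union>w\<in>hball 0 1. {q. f (q \<star> dil r w) < b})"
      by (auto simp: I_less)
    moreover have "open \<dots>"
      by (intro open_UN ballI open_Collect_less cont continuous_on_const)
    ultimately show "{q \<in> space borel. I q < b} \<in> sets borel" by simp
  qed
  obtain T :: "heis set" where T: "countable T"
    and dense: "\<And>X. open X \<Longrightarrow> X \<noteq> {} \<Longrightarrow> \<exists>t\<in>T. t \<in> X"
    using countable_dense_exists by blast
  have T': "T \<inter> hball 0 1 \<noteq> {}" using dense[OF open_hball ne] by blast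
  define e where "e = from_nat_into (T \<inter> hball 0 1)"
  have e_mem: "e n \<in> hball 0 1" for n
    using from_nat_into[OF T'] by (auto simp: e_def)
  have e_ex: "\<exists>n. f (q \<star> dil r (e n)) < I q + \<eta>" for q
  proof -
    \<comment> \<open>The near-optimal moves form a nonempty open set, so the dense set meets
      it.\<close>
    let ?X = "hball 0 1 \<inter> {w. f (q \<star> dil r w) < I q + \<eta>}"
    have "open ?X" by (intro open_Int open_hball open_Collect_less cont continuous_on_const)
    moreover have "?X \<noteq> {}" using I_less[of q "I q + \<eta>"] \<eta> by auto
    ultimately obtain t where "t \<in> T" "t \<in> ?X" using dense by blast
    moreover from this obtain n where "t = e n"
      using from_nat_into_surj[of "T \<inter> hball 0 1" t] T unfolding e_def by (metis IntE IntI countable_Int1)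
    ultimately show ?thesis by blast
  qed
  define s where "s q = e (LEAST n. f (q \<star> dil r (e n)) < I q + \<eta>)" for q
  have [measurable]: "(\<lambda>q. f (q \<star> dil r w)) \<in> borel_measurable borel" for w
    by (rule borel_measurable_continuous_onI) (rule cont)
  have "(\<lambda>q. LEAST n. f (q \<star> dil r (e n)) < I q + \<eta>) \<in> borel \<rightarrow>\<^sub>M count_space UNIV"
    by (rule measurable_Least) measurable
  then have "s \<in> borel_measurable borel"
    unfolding s_def by (rule measurable_compose) simp
  moreover have "f (q \<star> dil r (s q)) < I q + \<eta>" for q
    unfolding s_def by (rule LeastI_ex) (rule e_ex)
  moreover have "s q \<in> hball 0 1" for q unfolding s_def by (rule e_mem)
  ultimately show ?thesis unfolding I_def by blast
qed

text \<open>Play depending on the current position only. The case split reflects that a history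
  stores the initial position apart from the later ones.\<close>

definition stationary :: "(heis \<Rightarrow> heis) \<Rightarrow> strategy" where
  "stationary s n H = s (if n = 0 then fst H else fst (snd H n))"

lemma stationary_strategy:
  assumes s: "s \<in> borel_measurable borel" "\<And>q. s q \<in> hball 0 1"
  shows "stationary s \<in> strategies"
proof -
  have "(\<lambda>H. if n = 0 then fst H else fst (snd H n)) \<in> borel_measurable (Hist n)" for n
  proof (cases "n = 0")
    case True
    show ?thesis unfolding Hist_def if_P[OF True] by (rule measurable_fst)
  next
    case False
    have "(\<lambda>x. x n) \<in> PiM {1..n} (\<lambda>_. borel \<Otimes>\<^sub>M Omega1) \<rightarrow>\<^sub>M borel \<Otimes>\<^sub>M Omega1"
      using False by (intro measurable_component_singleton) auto
    from measurable_compose[OF measurable_compose[OF measurable_snd this] measurable_fst]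
    show ?thesis unfolding Hist_def if_not_P[OF False] .
  qed
  then have "stationary s n \<in> borel_measurable (Hist n)" for n
    unfolding stationary_def by (rule measurable_compose[OF _ s(1)])
  then show ?thesis
    using s(2) by (auto simp: strategies_def measurable_restrict_space2_iff stationary_def)
qed

lemma (in play) stationary_hist: "stationary s n (hist \<omega> n) = s (pos \<omega> n)"
  by (cases n) (simp_all add: stationary_def hist_def)

text \<open>Both seats are covered by the same strategy, so one statement yields the upper bound
  and, after a change of sign, the lower one.\<close>

lemma (in tug_of_war) dpp_near_optimal:
  assumes g: "0 < g" and v: "continuous_on UNIV v" "\<And>q. \<bar>v q\<bar> \<le> B"
    and F: "continuous_on UNIV F" "\<And>q. \<bar>F q\<bar> \<le> B"
    and dpp: "dpp p D F \<epsilon> v" and \<eta>: "0 < \<eta>"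
  shows "\<exists>\<sigma>\<in>strategies. \<forall>\<sigma>'\<in>strategies. expected_payoff p D F \<epsilon> q0 \<sigma> \<sigma>' \<le> v q0 + \<eta> \<and>
    expected_payoff p D F \<epsilon> q0 \<sigma>' \<sigma> \<le> v q0 + \<eta>"
proof -
  interpret N: prob_space noise by (rule prob_space_noise)
  have vm: "v \<in> borel_measurable borel" and Fm: "F \<in> borel_measurable borel"
    using v(1) F(1) by (simp_all add: borel_measurable_continuous_onI)
  obtain c h E where c: "0 < c" and hm: "h \<in> borel_measurable borel"
    and h: "\<forall>q. 0 \<le> h q \<and> h q \<le> E"
    and drift: "\<forall>q. \<forall>x\<in>hball 0 1. \<forall>y\<in>hball 0 1. dpp_op h (\<lambda>_. 0) q x y \<le> h q - c"
    using drift_function by blast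
  \<comment> \<open>Bounds the expected duration for every pair of strategies, so the accuracy can
    be fixed before any opponent is known.\<close>
  define S where "S = h q0 / c"
  have S0: "0 \<le> S" using c h[rule_format, of q0] by (simp add: S_def)
  \<comment> \<open>The added 1 covers \<open>S = 0\<close> and still gives
    \<open>\<delta> * S \<le> \<eta>\<close>.\<close>
  define \<delta> where "\<delta> = \<eta> / (S + 1)"
  have \<delta>: "0 < \<delta>" "\<delta> * S \<le> \<eta>"
    using \<eta> S0 by (auto simp: \<delta>_def field_simps)
  have A_bnd: "\<bar>A3 v \<epsilon> q\<bar> \<le> B" for q
    unfolding A3_eq_noise[OF vm eps_pos] using v(2) by (rule N.abs_expectation_le)
  obtain s where s: "s \<in> borel_measurable borel" "\<And>q. s q \<in> hball 0 1"
    and opt: "\<And>q. A3 v \<epsilon> (q \<star> dil g (s q)) < (INF q'\<in>hball q g. A3 v \<epsilon> q') + \<delta>"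
    using measurable_near_optimal_move[OF continuous_on_A3[OF v eps_pos] A_bnd g \<delta>(1)] by metis
  have sup: "A3 v \<epsilon> (q \<star> dil g y) \<le> (SUP q'\<in>hball q g. A3 v \<epsilon> q')" if "y \<in> hball 0 1" for q y
  proof (rule cSUP_upper)
    show "q \<star> dil g y \<in> hball q g"
      using that by (simp only: hmul_dil_mem_hball[OF g])
    show "bdd_above ((\<lambda>q'. A3 v \<epsilon> q') ` hball q g)"
      by (rule bdd_aboveI2[where M = B]) (rule abs_le_D1[OF A_bnd])
  qed
  have op: "dpp_op v F q (s q) y \<le> v q + \<delta>" "dpp_op v F q y (s q) \<le> v q + \<delta>"
    if y: "y \<in> hball 0 1" for q y
  proof -
    let ?a = "A3 v \<epsilon> q" and ?i = "INF q'\<in>hball q g. A3 v \<epsilon> q'" and ?s = "SUP q'\<in>hball q g. A3 v \<epsilon> q'"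
    \<comment> \<open>The near-minimal move replaces the infimum at a cost below
      \<open>\<delta>\<close>; the opponent's move, whatever it is, stays below the
      supremum.\<close>
    have "1/3 * ?a + 1/3 * A3 v \<epsilon> (q \<star> dil g (s q)) + 1/3 * A3 v \<epsilon> (q \<star> dil g y)
        \<le> (1/3 * ?a + 1/3 * ?i + 1/3 * ?s) + \<delta>"
      using opt[of q] sup[OF y, of q] \<delta>(1) by linarith
    from mult_left_mono[OF this d_nonneg[of q]]
    have "dpp_op v F q (s q) y \<le> d q * (1/3 * ?a + 1/3 * ?i + 1/3 * ?s) + (1 - d q) * F q + d q * \<delta>"
      by (simp add: dpp_op_def algebra_simps)
    also have "\<dots> = v q + d q * \<delta>"
      using dpp unfolding dpp_def by (simp only:)
    also have "\<dots> \<le> v q + \<delta>"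
      using d_le_1[of q] d_nonneg[of q] \<delta>(1) by (simp add: mult_left_le_one_le)
    finally show "dpp_op v F q (s q) y \<le> v q + \<delta>" .
    then show "dpp_op v F q y (s q) \<le> v q + \<delta>"
      by (simp add: dpp_op_def algebra_simps)
  qed
  have str: "stationary s \<in> strategies" by (rule stationary_strategy[OF s])
  have sum_le: "(\<Sum>k<n. play.alive_prob p \<epsilon> D q0 \<sigma>I \<sigma>II k) \<le> S"
    if "\<sigma>I \<in> strategies" "\<sigma>II \<in> strategies" for \<sigma>I \<sigma>II n
  proof -
    interpret play p \<epsilon> D q0 \<sigma>I \<sigma>II by unfold_locales fact+
    show ?thesis
      using sum_alive_prob_le[OF hm conjunct1[OF h[rule_format]] conjunct2[OF h[rule_format]]
          drift[rule_format], of n] c by (simp add: S_def field_simps)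
  qed
  have *: "expected_payoff p D F \<epsilon> q0 \<sigma>I \<sigma>II \<le> v q0 + \<eta>"
    if st: "\<sigma>I \<in> strategies" "\<sigma>II \<in> strategies" "\<sigma>I = stationary s \<or> \<sigma>II = stationary s" for \<sigma>I \<sigma>II
  proof -
    interpret play p \<epsilon> D q0 \<sigma>I \<sigma>II by unfold_locales fact+
    have "expected_payoff p D F \<epsilon> q0 \<sigma>I \<sigma>II \<le> v q0 + \<delta> * S"
    proof (rule expected_payoff_le[OF vm v(2) Fm F(2)])
      show "moves_op v F n \<omega> \<le> v (pos \<omega> n) + \<delta>" if "\<omega> \<in> space Omega" for n \<omega>
        using st(3)
      proof
        assume "\<sigma>I = stationary s"
        then have eq: "\<sigma>I n H = stationary s n H" for H by simp
        show ?thesis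
          unfolding moves_op_def eq stationary_hist by (rule op(1)[OF move_mem_hball(2)[OF that]])
      next
        assume "\<sigma>II = stationary s"
        then have eq: "\<sigma>II n H = stationary s n H" for H by simp
        show ?thesis
          unfolding moves_op_def eq stationary_hist by (rule op(2)[OF move_mem_hball(1)[OF that]])
      qed
      show "0 \<le> \<delta>" using \<delta>(1) by simp
      show "(\<Sum>k<n. alive_prob k) \<le> S" for n using st(1,2) by (rule sum_le)
    qed
    then show ?thesis using \<delta>(2) by simp
  qed
  show ?thesis using str * by blast
qed

text \<open>The order of the two values is automatic, and near-optimal play by each side squeezes
  them onto \<open>u\<close>. The uniform bound makes all suprema and infima of reals
  genuine.\<close>

lemma sup_inf_eq_inf_supI:
  fixes f :: "'a \<Rightarrow> 'b \<Rightarrow> real"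
  assumes B: "\<And>x y. \<bar>f x y\<bar> \<le> B"
    and lower: "\<And>\<eta>. 0 < \<eta> \<Longrightarrow> \<exists>x\<in>X. \<forall>y\<in>Y. u - \<eta> \<le> f x y"
    and upper: "\<And>\<eta>. 0 < \<eta> \<Longrightarrow> \<exists>y\<in>Y. \<forall>x\<in>X. f x y \<le> u + \<eta>"
  shows "(SUP x\<in>X. INF y\<in>Y. f x y) = u" "(INF y\<in>Y. SUP x\<in>X. f x y) = u"
proof -
  have ne: "X \<noteq> {}" "Y \<noteq> {}" using lower[of 1] upper[of 1] by auto
  have B': "- B \<le> f x y" "f x y \<le> B" for x y using B[of x y] by auto
  have bdd [simp]: "bdd_below ((\<lambda>y. f x y) ` Y)" "bdd_above ((\<lambda>x. f x y) ` X)" for x y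
    using B' by (auto intro: bdd_belowI2[where m = "- B"] bdd_aboveI2[where M = B])
  have I_le: "(INF y\<in>Y. f x y) \<le> f x y" if "y \<in> Y" for x y
    using that by (intro cINF_lower) auto
  have S_ge: "f x y \<le> (SUP x\<in>X. f x y)" if "x \<in> X" for x y
    using that by (intro cSUP_upper) auto
  have bddI: "bdd_above ((\<lambda>x. INF y\<in>Y. f x y) ` X)"
    using I_le B'(2) ne by (intro bdd_aboveI2[where M = B]) (meson ex_in_conv order_trans)
  have bddS: "bdd_below ((\<lambda>y. SUP x\<in>X. f x y) ` Y)"
    using S_ge B'(1) ne by (intro bdd_belowI2[where m = "- B"]) (meson ex_in_conv order_trans)
  have le: "(SUP x\<in>X. INF y\<in>Y. f x y) \<le> (INF y\<in>Y. SUP x\<in>X. f x y)"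
    using ne by (intro cSUP_least cINF_greatest order_trans[OF I_le S_ge])
  have ge: "u \<le> (SUP x\<in>X. INF y\<in>Y. f x y)"
  proof (rule field_le_epsilon)
    fix \<eta> :: real assume "0 < \<eta>"
    then obtain x where x: "x \<in> X" "\<forall>y\<in>Y. u - \<eta> \<le> f x y" using lower by blast
    then have "u - \<eta> \<le> (INF y\<in>Y. f x y)" using ne by (intro cINF_greatest) auto
    also have "\<dots> \<le> (SUP x\<in>X. INF y\<in>Y. f x y)" using x bddI by (intro cSUP_upper)
    finally show "u \<le> (SUP x\<in>X. INF y\<in>Y. f x y) + \<eta>" by simp
  qed
  have "(INF y\<in>Y. SUP x\<in>X. f x y) \<le> u"
  proof (rule field_le_epsilon)
    fix \<eta> :: real assume "0 < \<eta>"
    then obtain y where y: "y \<in> Y" "\<forall>x\<in>X. f x y \<le> u + \<eta>" using upper by blast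
    have "(INF y\<in>Y. SUP x\<in>X. f x y) \<le> (SUP x\<in>X. f x y)" using y bddS by (intro cINF_lower)
    also have "\<dots> \<le> u + \<eta>" using y ne by (intro cSUP_least) auto
    finally show "(INF y\<in>Y. SUP x\<in>X. f x y) \<le> u + \<eta>" .
  qed
  with le ge show "(SUP x\<in>X. INF y\<in>Y. f x y) = u" "(INF y\<in>Y. SUP x\<in>X. f x y) = u"
    by auto
qed

section \<open>Change of sign and the identification of the values\<close>

lemma real_SUP_uminus: "(SUP x\<in>A. - f x :: real) = - (INF x\<in>A. f x)"
  \<comment> \<open>On the reals \<open>Inf\<close> is by definition the negated \<open>Sup\<close>
    of the negated set, so the identity holds for every set.\<close>
  unfolding Inf_real_def by (simp add: image_image)

text \<open>Negation exchanges the infimum and supremum terms, whose weights are equal.\<close>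

lemma dpp_uminus:
  assumes "dpp p D F \<epsilon> u"
  shows "dpp p D (\<lambda>q. - F q) \<epsilon> (\<lambda>q. - u q)"
proof -
  have A: "A3 (\<lambda>q. - u q) \<epsilon> q = - A3 u \<epsilon> q" for q
    by (simp add: A3_def set_lebesgue_integral_def)
  have I: "(INF x\<in>X. - f x) = - (SUP x\<in>X. f x)" for f :: "heis \<Rightarrow> real" and X
    using real_SUP_uminus[of "\<lambda>x. - f x" X] by simp
  show ?thesis
    unfolding dpp_def A I real_SUP_uminus
  proof
    fix q
    from assms[unfolded dpp_def, rule_format, of q] show "- u q = d_eps D \<epsilon> q *
        (1/3 * - A3 u \<epsilon> q + 1/3 * - (SUP q'\<in>hball q (gam p * \<epsilon>). A3 u \<epsilon> q')
          + 1/3 * - (INF q'\<in>hball q (gam p * \<epsilon>). A3 u \<epsilon> q')) + (1 - d_eps D \<epsilon> q) * - F q"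
      by (simp add: algebra_simps)
  qed
qed

theorem theorem11p3:
  fixes p \<epsilon> :: real and D :: "heis set" and F :: "heis \<Rightarrow> real" and u\<^sub>\<epsilon> :: "heis \<Rightarrow> real"
  assumes "p > 2"
    and "open D" and "bounded D" and "connected D"
    and "continuous_on UNIV F" and "bounded (range F)"
    and "\<epsilon> \<in> {0<..<1}"
    and "continuous_on UNIV u\<^sub>\<epsilon>" and "bounded (range u\<^sub>\<epsilon>)" and "dpp p D F \<epsilon> u\<^sub>\<epsilon>"
  shows "\<forall>q. value_I p D F \<epsilon> q = u\<^sub>\<epsilon> q \<and> u\<^sub>\<epsilon> q = value_II p D F \<epsilon> q"
proof
  fix q
  interpret tug_of_war p \<epsilon> D using assms by unfold_locales auto
  interpret P: prob_space Omega by (rule prob_space_Omega)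
  have g: "0 < gam p * \<epsilon>" using assms by (simp add: gam_def)
  obtain B1 B2 where "\<And>q. \<bar>F q\<bar> \<le> B1" "\<And>q. \<bar>u\<^sub>\<epsilon> q\<bar> \<le> B2"
    using assms(6,9) by (auto simp: bounded_iff)
  then have F: "\<bar>F q\<bar> \<le> max B1 B2" and u: "\<bar>u\<^sub>\<epsilon> q\<bar> \<le> max B1 B2" for q
    by (auto simp: le_max_iff_disj)
  have neg: "expected_payoff p D (\<lambda>q. - F q) \<epsilon> q \<sigma> \<sigma>' = - expected_payoff p D F \<epsilon> q \<sigma> \<sigma>'" for \<sigma> \<sigma>'
    by (simp add: expected_payoff_def)
  have B: "\<bar>expected_payoff p D F \<epsilon> q \<sigma> \<sigma>'\<bar> \<le> max B1 B2" for \<sigma> \<sigma>'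
    unfolding expected_payoff_def by (rule P.abs_expectation_le) (rule F)
  have upper: "\<exists>\<sigma>'\<in>strategies. \<forall>\<sigma>\<in>strategies. expected_payoff p D F \<epsilon> q \<sigma> \<sigma>' \<le> u\<^sub>\<epsilon> q + \<eta>"
    if "0 < \<eta>" for \<eta>
    using dpp_near_optimal[OF g assms(8) u assms(5) F assms(10) that, of q] by blast
  \<comment> \<open>The near-minimising strategy for the negated data, placed in the seat of Player
    I, nearly maximises the original payoff.\<close>
  have lower: "\<exists>\<sigma>\<in>strategies. \<forall>\<sigma>'\<in>strategies. u\<^sub>\<epsilon> q - \<eta> \<le> expected_payoff p D F \<epsilon> q \<sigma> \<sigma>'"
    if "0 < \<eta>" for \<eta>
  proof -
    have "\<bar>- u\<^sub>\<epsilon> q\<bar> \<le> max B1 B2" "\<bar>- F q\<bar> \<le> max B1 B2" for q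
      using u[of q] F[of q] by simp_all
    from dpp_near_optimal[OF g continuous_on_minus[OF assms(8)] this(1)
        continuous_on_minus[OF assms(5)] this(2) dpp_uminus[OF assms(10)] that, of q]
    obtain \<sigma> where \<sigma>: "\<sigma> \<in> strategies"
      "\<forall>\<sigma>'\<in>strategies. expected_payoff p D (\<lambda>q. - F q) \<epsilon> q \<sigma> \<sigma>' \<le> - u\<^sub>\<epsilon> q + \<eta>"
      by blast
    have "u\<^sub>\<epsilon> q - \<eta> \<le> expected_payoff p D F \<epsilon> q \<sigma> \<sigma>'" if "\<sigma>' \<in> strategies" for \<sigma>'
      using bspec[OF \<sigma>(2) that] unfolding neg by simp
    with \<sigma>(1) show ?thesis by blast
  qed
  show "value_I p D F \<epsilon> q = u\<^sub>\<epsilon> q \<and> u\<^sub>\<epsilon> q = value_II p D F \<epsilon> q"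
    unfolding value_I_def value_II_def
    using sup_inf_eq_inf_supI[of "expected_payoff p D F \<epsilon> q", OF B lower upper] by simp
qed

end
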